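(* Let $\boldsymbol{x}=(x_1,\dots,x_M)\in\mathbb{R}^M$ with $x_1<\cdots<x_M$ and $\boldsymbol{y}\in\mathbb{R}^M$ with $M\ge2$, let $E:\mathbb{R}\times\mathbb{R}\to\mathbb{R}^+$ be such that $E(\cdot,y)$ is strictly convex, coercive, and differentiable for any $y\in\mathbb{R}$, and let $\lambda>0$. Let $f_{\mathrm{opt}}$ be obtained through the following two-step procedure: 1. compute $\boldsymbol{y}_\lambda\in\mathbb{R}^M$ by solving $\boldsymbol{y}_\lambda=\operatorname{arg\,min}_{\boldsymbol{z}\in\mathbb{R}^M}\sum_{m=1}^ME(z_m,y_m)+\lambda\|\mathbf{L}\boldsymbol{z}\|_1$; 2. let $f_{\mathrm{opt}}$ be the output of the sparsification algorithm applied to $(\boldsymbol{x},\boldsymbol{y}_0)$ with $\boldsymbol{y}_0=\boldsymbol{y}_\lambda$. Then $f_{\mathrm{opt}}$ is one of the sparsest solutions of (gBLASSO) (i.e., it is a solution, and no piecewise-linear spline solution of (gBLASSO) has fewer knots), with sparsity $K_{\min}(\boldsymbol{x},\boldsymbol{y}_\lambda)$.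
   Context: $\mathcal{M}(\mathbb{R})$ is the space of bounded (finite, signed) Radon measures on $\mathbb{R}$ with total-variation norm $\|\cdot\|_{\mathcal{M}}$. $\mathrm{BV}^{(2)}(\mathbb{R})=\{f\in\mathcal{S}'(\mathbb{R}):\mathrm{D}^2f\in\mathcal{M}(\mathbb{R})\}$, where $\mathrm{D}^2$ is the distributional second derivative; its elements are continuous functions. Write $(t)_+=\max(0,t)$. A piecewise-linear spline is $f\in\mathrm{BV}^{(2)}(\mathbb{R})$ with $\mathrm{D}^2f=\sum_{k=1}^Ka_k\delta(\cdot-\tau_k)$ (distinct $\tau_k$, nonzero $a_k$); the $\tau_k$ are its knots and $K$ its sparsity. (gBLASSO) is the problem of minimizing $\sum_{m=1}^ME(f(x_m),y_m)+\lambda\|\mathrm{D}^2f\|_{\mathcal{M}}$ over $f\in\mathrm{BV}^{(2)}(\mathbb{R})$. $\mathbf{L}\in\mathbb{R}^{(M-2)\times M}$ is defined by $(\mathbf{L}\boldsymbol{z})_i=v_iz_i-(v_i+v_{i+1})z_{i+1}+v_{i+1}z_{i+2}$, $i=1,\dots,M-2$, where $v_m=\frac1{x_{m+1}-x_m}$. The minimizer in step 1 exists and is unique. Quantities attached to $(\boldsymbol{x},\boldsymbol{y}_0)$: $a_1=\frac{y_{0,2}-y_{0,1}}{x_2-x_1}$, $a_m=\frac{y_{0,m+1}-y_{0,m}}{x_{m+1}-x_m}-\frac{y_{0,m}-y_{0,m-1}}{x_m-x_{m-1}}$ for $2\le m\le M-1$, and (affine constant) $b=y_{0,1}-a_1x_1$.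 Set $e_1=e_M=0$ and $e_m=\mathrm{sign}(a_m)$ for $2\le m\le M-1$ ($\mathrm{sign}(0)=0$). Let $\{m\in\{2,\dots,M-1\}:e_m=\pm1,\ e_m\neq e_{m-1}\}=\{s_1<\dots<s_{N_s}\}$ and $\alpha_n=\min\{k\in\mathbb{N}:e_{s_n+k+1}\ne e_{s_n}\}$ (with $0\in\mathbb{N}$). Define $K_{\min}(\boldsymbol{x},\boldsymbol{y}_0)=\sum_{n=1}^{N_s}\lceil\frac{\alpha_n+1}{2}\rceil$. Sparsification algorithm, input $(\boldsymbol{x},\boldsymbol{y}_0)$: for each $n\in\{1,\dots,N_s\}$, with $s=s_n$, produce $P=\lceil\frac{\alpha_n+1}2\rceil$ pairs (weight, knot) $(\tilde a_p,\tilde\tau_p)$: - if $\alpha_n=2k+1$ is odd: for $i=0,\dots,k$, $\tilde a_{i+1}=a_{s+2i}+a_{s+2i+1}$ and $\tilde\tau_{i+1}=\frac{a_{s+2i}x_{s+2i}+a_{s+2i+1}x_{s+2i+1}}{\tilde a_{i+1}}$; - if $\alpha_n=2k$ is even (including $0$): $\tilde a_1=a_s$, $\tilde\tau_1=x_s$, and for $i=1,\dots,k$, $\tilde a_{i+1}=a_{s+2i-1}+a_{s+2i}$ and $\tilde\tau_{i+1}=\frac{a_{s+2i-1}x_{s+2i-1}+a_{s+2i}x_{s+2i}}{\tilde a_{i+1}}$. Concatenate all pairs over $n$ into a list $(\hat a_k,\hat\tau_k)_{k=1}^K$ and return the function $x\mapsto a_1x+b+\sum_{k=1}^K\hat a_k(x-\hat\tau_k)_+$.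 *)

theory Defs
  imports "HOL-Analysis.Analysis"
begin

section \<open>Schwartz functions and tempered distributions on the real line\<close>

definition schwartz :: "(real \<Rightarrow> real) set" where
  "schwartz = {\<phi>. (\<forall>n t. (deriv ^^ n) \<phi> differentiable (at t)) \<and>
                  (\<forall>k n. bounded (range (\<lambda>t. t ^ k * (deriv ^^ n) \<phi> t)))}"

definition schwartz_seminorm :: "nat \<Rightarrow> nat \<Rightarrow> (real \<Rightarrow> real) \<Rightarrow> real" where
  "schwartz_seminorm k n \<phi> = (SUP t. \<bar>t ^ k * (deriv ^^ n) \<phi> t\<bar>)"

text \<open>
  Only the values of a functional on Schwartz functions are relevant. Continuity for the
  Frechet topology is expressed by domination by finitely many seminorms.
\<close>

definition tempered_distribution :: "((real \<Rightarrow> real) \<Rightarrow> real) \<Rightarrow> bool" where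
  "tempered_distribution T \<longleftrightarrow>
     (\<forall>\<phi>\<in>schwartz. \<forall>\<psi>\<in>schwartz. T (\<lambda>t. \<phi> t + \<psi> t) = T \<phi> + T \<psi>) \<and>
     (\<forall>c. \<forall>\<phi>\<in>schwartz. T (\<lambda>t. c * \<phi> t) = c * T \<phi>) \<and>
     (\<exists>C N. \<forall>\<phi>\<in>schwartz. \<bar>T \<phi>\<bar> \<le> C * (\<Sum>k\<le>N. \<Sum>n\<le>N. schwartz_seminorm k n \<phi>))"

definition distr_deriv :: "((real \<Rightarrow> real) \<Rightarrow> real) \<Rightarrow> (real \<Rightarrow> real) \<Rightarrow> real" where
  "distr_deriv T = (\<lambda>\<phi>. - T (deriv \<phi>))"

definition distr_of_fun :: "(real \<Rightarrow> real) \<Rightarrow> (real \<Rightarrow> real) \<Rightarrow> real" where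
  "distr_of_fun f = (\<lambda>\<phi>. integral\<^sup>L lborel (\<lambda>t. f t * \<phi> t))"


section \<open>Finite signed measures on the real line\<close>

text \<open>
  A finite signed measure is a real-valued countably additive set function on the Borel sets
  (every such set function is a Radon measure). It is normalised to be 0 on non-Borel sets,
  so that two measures are equal as functions iff they agree on all Borel sets.
\<close>

definition finite_signed_measure :: "(real set \<Rightarrow> real) \<Rightarrow> bool" where
  "finite_signed_measure \<nu> \<longleftrightarrow>
     (\<forall>A. A \<notin> sets borel \<longrightarrow> \<nu> A = 0) \<and>
     \<nu> {} = 0 \<and>
     (\<forall>A :: nat \<Rightarrow> real set. range A \<subseteq> sets borel \<longrightarrow> disjoint_family A \<longrightarrow>
        (\<lambda>n. \<nu> (A n)) sums \<nu> (\<Union>n. A n))"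

text \<open>
  Positive part of the Jordan decomposition; the negative part of \<open>\<nu>\<close> is the
  positive part of \<open>-\<nu>\<close>. Both are finite measures whenever \<open>\<nu>\<close> is a finite signed measure.
\<close>

definition pos_variation :: "(real set \<Rightarrow> real) \<Rightarrow> real measure" where
  "pos_variation \<nu> = measure_of UNIV (sets borel)
     (\<lambda>A. SUP B \<in> {B \<in> sets borel. B \<subseteq> A}. ennreal (\<nu> B))"

definition neg_variation :: "(real set \<Rightarrow> real) \<Rightarrow> real measure" where
  "neg_variation \<nu> = pos_variation (\<lambda>A. - \<nu> A)"

definition signed_integral :: "(real set \<Rightarrow> real) \<Rightarrow> (real \<Rightarrow> real) \<Rightarrow> real" where
  "signed_integral \<nu> \<phi> = integral\<^sup>L (pos_variation \<nu>) \<phi> - integral\<^sup>L (neg_variation \<nu>) \<phi>"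

definition tv_norm :: "(real set \<Rightarrow> real) \<Rightarrow> real" where
  "tv_norm \<nu> = measure (pos_variation \<nu>) UNIV + measure (neg_variation \<nu>) UNIV"

definition dirac :: "real \<Rightarrow> real set \<Rightarrow> real" where
  "dirac \<tau> A = (if A \<in> sets borel \<and> \<tau> \<in> A then 1 else 0)"


section \<open>The space of functions whose second derivative is a finite measure\<close>

definition has_D2 :: "(real \<Rightarrow> real) \<Rightarrow> (real set \<Rightarrow> real) \<Rightarrow> bool" where
  "has_D2 f \<nu> \<longleftrightarrow> finite_signed_measure \<nu> \<and>
     (\<forall>\<phi>\<in>schwartz. distr_deriv (distr_deriv (distr_of_fun f)) \<phi> = signed_integral \<nu> \<phi>)"

definition D2 :: "(real \<Rightarrow> real) \<Rightarrow> real set \<Rightarrow> real" where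
  "D2 f = (THE \<nu>. has_D2 f \<nu>)"

text \<open>
  A tempered distribution whose second derivative is a finite measure is a continuous function
  of at most linear growth. Elements of the space are identified with this continuous
  representative; the integrability condition then excludes nothing and ensures that no
  Bochner integral in \<^const>\<open>distr_of_fun\<close> takes its default value.
\<close>

definition BV2 :: "(real \<Rightarrow> real) set" where
  "BV2 = {f. continuous_on UNIV f \<and>
             (\<forall>\<phi>\<in>schwartz. integrable lborel (\<lambda>t. f t * \<phi> t)) \<and>
             tempered_distribution (distr_of_fun f) \<and>
             (\<exists>\<nu>. has_D2 f \<nu>)}"

definition pl_spline_with_sparsity :: "(real \<Rightarrow> real) \<Rightarrow> nat \<Rightarrow> bool" where
  "pl_spline_with_sparsity f K \<longleftrightarrow> f \<in> BV2 \<and>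
     (\<exists>T a. finite T \<and> card T = K \<and> (\<forall>\<tau>\<in>T. a \<tau> \<noteq> 0) \<and>
            D2 f = (\<lambda>A. \<Sum>\<tau>\<in>T. a \<tau> * dirac \<tau> A))"


section \<open>The optimization problems\<close>

definition strictly_convex :: "(real \<Rightarrow> real) \<Rightarrow> bool" where
  "strictly_convex g \<longleftrightarrow>
     (\<forall>u v t. u \<noteq> v \<longrightarrow> 0 < t \<longrightarrow> t < 1 \<longrightarrow>
        g ((1 - t) * u + t * v) < (1 - t) * g u + t * g v)"

definition coercive :: "(real \<Rightarrow> real) \<Rightarrow> bool" where
  "coercive g \<longleftrightarrow> filterlim g at_top at_infinity"

text \<open>
  Vectors in \<open>\<real>\<^sup>M\<close> are functions on \<^typ>\<open>nat\<close> of which only the values at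
  \<open>1, \<dots>, M\<close> are used.
\<close>

definition gBLASSO_cost ::
  "nat \<Rightarrow> (nat \<Rightarrow> real) \<Rightarrow> (nat \<Rightarrow> real) \<Rightarrow> (real \<Rightarrow> real \<Rightarrow> real) \<Rightarrow> real \<Rightarrow> (real \<Rightarrow> real) \<Rightarrow> real" where
  "gBLASSO_cost M x y E lam f = (\<Sum>m=1..M. E (f (x m)) (y m)) + lam * tv_norm (D2 f)"

definition gBLASSO_solution ::
  "nat \<Rightarrow> (nat \<Rightarrow> real) \<Rightarrow> (nat \<Rightarrow> real) \<Rightarrow> (real \<Rightarrow> real \<Rightarrow> real) \<Rightarrow> real \<Rightarrow> (real \<Rightarrow> real) \<Rightarrow> bool" where
  "gBLASSO_solution M x y E lam f \<longleftrightarrow> is_arg_min (gBLASSO_cost M x y E lam) (\<lambda>g. g \<in> BV2) f"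

definition sparsest_gBLASSO_solution ::
  "nat \<Rightarrow> (nat \<Rightarrow> real) \<Rightarrow> (nat \<Rightarrow> real) \<Rightarrow> (real \<Rightarrow> real \<Rightarrow> real) \<Rightarrow> real \<Rightarrow> (real \<Rightarrow> real) \<Rightarrow> bool" where
  "sparsest_gBLASSO_solution M x y E lam f \<longleftrightarrow>
     gBLASSO_solution M x y E lam f \<and>
     (\<exists>K. pl_spline_with_sparsity f K \<and>
          (\<forall>g K'. gBLASSO_solution M x y E lam g \<and> pl_spline_with_sparsity g K' \<longrightarrow> K \<le> K'))"

definition inv_gap :: "(nat \<Rightarrow> real) \<Rightarrow> nat \<Rightarrow> real" where
  "inv_gap x m = 1 / (x (m + 1) - x m)"

definition L_op :: "(nat \<Rightarrow> real) \<Rightarrow> (nat \<Rightarrow> real) \<Rightarrow> nat \<Rightarrow> real" where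
  "L_op x z i = inv_gap x i * z i - (inv_gap x i + inv_gap x (i + 1)) * z (i + 1)
                + inv_gap x (i + 1) * z (i + 2)"

definition discrete_cost ::
  "nat \<Rightarrow> (nat \<Rightarrow> real) \<Rightarrow> (nat \<Rightarrow> real) \<Rightarrow> (real \<Rightarrow> real \<Rightarrow> real) \<Rightarrow> real \<Rightarrow> (nat \<Rightarrow> real) \<Rightarrow> real" where
  "discrete_cost M x y E lam z = (\<Sum>m=1..M. E (z m) (y m)) + lam * (\<Sum>i=1..M-2. \<bar>L_op x z i\<bar>)"


section \<open>The sparsification algorithm\<close>

definition pl_coeff :: "(nat \<Rightarrow> real) \<Rightarrow> (nat \<Rightarrow> real) \<Rightarrow> nat \<Rightarrow> real" where
  "pl_coeff x y0 m =
     (if m = 1 then (y0 2 - y0 1) / (x 2 - x 1)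
      else (y0 (m + 1) - y0 m) / (x (m + 1) - x m) - (y0 m - y0 (m - 1)) / (x m - x (m - 1)))"

definition affine_const :: "(nat \<Rightarrow> real) \<Rightarrow> (nat \<Rightarrow> real) \<Rightarrow> real" where
  "affine_const x y0 = y0 1 - pl_coeff x y0 1 * x 1"

definition coeff_sign :: "nat \<Rightarrow> (nat \<Rightarrow> real) \<Rightarrow> (nat \<Rightarrow> real) \<Rightarrow> nat \<Rightarrow> real" where
  "coeff_sign M x y0 m = (if 2 \<le> m \<and> m \<le> M - 1 then sgn (pl_coeff x y0 m) else 0)"

definition block_starts :: "nat \<Rightarrow> (nat \<Rightarrow> real) \<Rightarrow> (nat \<Rightarrow> real) \<Rightarrow> nat set" where
  "block_starts M x y0 = {m \<in> {2..M-1}. coeff_sign M x y0 m \<in> {1, -1} \<and>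
                                        coeff_sign M x y0 m \<noteq> coeff_sign M x y0 (m - 1)}"

definition block_alpha :: "nat \<Rightarrow> (nat \<Rightarrow> real) \<Rightarrow> (nat \<Rightarrow> real) \<Rightarrow> nat \<Rightarrow> nat" where
  "block_alpha M x y0 s = (LEAST k. coeff_sign M x y0 (s + k + 1) \<noteq> coeff_sign M x y0 s)"

definition K_min :: "nat \<Rightarrow> (nat \<Rightarrow> real) \<Rightarrow> (nat \<Rightarrow> real) \<Rightarrow> nat" where
  "K_min M x y0 = (\<Sum>s\<in>block_starts M x y0. nat \<lceil>real (block_alpha M x y0 s + 1) / 2\<rceil>)"

definition merge_pair :: "(nat \<Rightarrow> real) \<Rightarrow> (nat \<Rightarrow> real) \<Rightarrow> nat \<Rightarrow> real \<times> real" where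
  "merge_pair x y0 m =
     (let a = pl_coeff x y0; w = a m + a (m + 1)
      in (w, (a m * x m + a (m + 1) * x (m + 1)) / w))"

text \<open>With \<open>\<alpha> = 2k + 1\<close> or \<open>\<alpha> = 2k\<close>, the number \<open>k\<close> is \<open>\<alpha> div 2\<close>.\<close>

definition block_pairs :: "nat \<Rightarrow> (nat \<Rightarrow> real) \<Rightarrow> (nat \<Rightarrow> real) \<Rightarrow> nat \<Rightarrow> (real \<times> real) list" where
  "block_pairs M x y0 s =
     (let k = block_alpha M x y0 s div 2
      in if odd (block_alpha M x y0 s)
         then map (\<lambda>i. merge_pair x y0 (s + 2 * i)) [0..<k + 1]
         else (pl_coeff x y0 s, x s) # map (\<lambda>i. merge_pair x y0 (s + 2 * i - 1)) [1..<k + 1])"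

definition sparsify_pairs :: "nat \<Rightarrow> (nat \<Rightarrow> real) \<Rightarrow> (nat \<Rightarrow> real) \<Rightarrow> (real \<times> real) list" where
  "sparsify_pairs M x y0 =
     concat (map (block_pairs M x y0) (sorted_list_of_set (block_starts M x y0)))"

definition sparsify :: "nat \<Rightarrow> (nat \<Rightarrow> real) \<Rightarrow> (nat \<Rightarrow> real) \<Rightarrow> real \<Rightarrow> real" where
  "sparsify M x y0 = (\<lambda>t. pl_coeff x y0 1 * t + affine_const x y0
     + (\<Sum>(w, \<tau>)\<leftarrow>sparsify_pairs M x y0. w * max 0 (t - \<tau>)))"

end

theory Submission
  imports Defs
begin

text \<open>
  The continuous and the discrete problem have the same minimal value, and a function \<open>g\<close> solves the
  continuous problem exactly when its samples \<open>g(x\<^sub>m)\<close> are the minimizer \<open>z\<close> of the discrete problem and its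
  total variation \<open>\<parallel>D\<^sup>2 g\<parallel>\<close> equals \<open>\<Sum> \<bar>a\<^sub>m\<bar>\<close>, the sum of the absolute slope changes of the linear interpolant of \<open>z\<close>.

  Lower bound. The second divided differences \<open>a\<^sub>m\<close> of any \<open>g\<close> in the space are integrals of hat functions
  against \<open>D\<^sup>2 g\<close> (\<open>divided_difference_eq_signed_integral\<close>). The hats form a partial partition of unity, so
  combining them with the signs \<open>e\<^sub>m\<close> of \<open>a\<^sub>m\<close> gives a test function \<open>u\<close> with \<open>\<bar>u\<bar> \<le> 1\<close> and
  \<open>\<Sum> \<bar>a\<^sub>m\<bar> = \<integral> u dD\<^sup>2 g \<le> \<parallel>D\<^sup>2 g\<parallel>\<close> (\<open>sum_abs_pl_coeff_le_tv_norm\<close>). Hats are not Schwartz functions. They are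
  replaced by combinations of softplus functions, which are, and whose second derivatives are combinations
  of sharpening logistic kernels. The same formula shows that \<open>f\<close> determines its measure \<open>D\<^sup>2 f\<close>.

  Attainment. Merging two neighbouring hinges of the same sign keeps the values at all nodes and the total
  absolute weight. So the sparsified spline interpolates \<open>z\<close> (\<open>sparsify_interpolates\<close>) with total variation at
  most \<open>\<Sum> \<bar>a\<^sub>m\<bar>\<close>, and it is a solution.

  Number of knots. By strict convexity every solution has the samples \<open>z\<close> (\<open>discrete_minimizer_unique\<close>), so its
  total variation is \<open>\<Sum> \<bar>a\<^sub>m\<bar>\<close>. If it is a spline with knots \<open>\<tau>\<close>, equality above forces \<open>\<bar>u(\<tau>)\<bar> = 1\<close> at each knot.
  Hence no knot lies strictly between neighbouring nodes with opposite signs. Choose every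
  second node from each block of equal signs. There are \<open>K\<^sub>m\<^sub>i\<^sub>n\<close> such nodes (\<open>card_alternate_nodes\<close>), each needs a
  knot inside the support of its hat, and no knot serves two of them
  (\<open>card_le_sparsity_if_minimal_variation\<close>). Conversely, the list of pairs produced by the algorithm has length
  \<open>K\<^sub>m\<^sub>i\<^sub>n\<close>, so the sparsified spline has at most \<open>K\<^sub>m\<^sub>i\<^sub>n\<close> knots. The lower bound, applied to this spline itself,
  shows that it has exactly \<open>K\<^sub>m\<^sub>i\<^sub>n\<close>. In particular the merged knots are distinct.
\<close>

section \<open>Jordan decomposition of finite signed measures\<close>

lemma finite_signed_measure_Un:
  assumes "finite_signed_measure \<nu>" "A \<in> sets borel" "B \<in> sets borel" "A \<inter> B = {}"
  shows "\<nu> (A \<union> B) = \<nu> A + \<nu> B"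
proof -
  have "(\<lambda>n. \<nu> (binaryset A B n)) sums \<nu> (\<Union>n. binaryset A B n)"
  proof -
    have "range (binaryset A B) \<subseteq> sets borel" "disjoint_family (binaryset A B)"
      using assms by (auto simp: range_binaryset_eq disjoint_family_on_def binaryset_def)
    then show ?thesis
      using assms(1) unfolding finite_signed_measure_def by blast
  qed
  moreover have "(\<lambda>n. \<nu> (binaryset A B n)) sums (\<nu> A + \<nu> B)"
    using assms(1) by (intro binaryset_sums) (simp add: finite_signed_measure_def)
  ultimately show ?thesis
    using sums_unique2 by (fastforce simp: UN_binaryset_eq)
qed

lemma finite_signed_measure_Diff:
  assumes "finite_signed_measure \<nu>" "A \<in> sets borel" "B \<in> sets borel" "B \<subseteq> A"
  shows "\<nu> (A - B) = \<nu> A - \<nu> B"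
proof -
  have "\<nu> (B \<union> (A - B)) = \<nu> B + \<nu> (A - B)"
    using assms by (intro finite_signed_measure_Un) auto
  moreover have "B \<union> (A - B) = A" using assms(4) by auto
  ultimately show ?thesis by simp
qed

lemma finite_signed_measure_uminus:
  assumes "finite_signed_measure \<nu>"
  shows "finite_signed_measure (\<lambda>A. - \<nu> A)"
  using assms unfolding finite_signed_measure_def by (auto intro: sums_minus)

lemma neg_variation_uminus: "neg_variation (\<lambda>A. - \<nu> A) = pos_variation \<nu>"
  by (simp add: neg_variation_def)

text \<open>
  The set function from which the positive variation is generated.
\<close>

definition upper_variation :: "(real set \<Rightarrow> real) \<Rightarrow> real set \<Rightarrow> ennreal" where
  "upper_variation \<nu> A = (SUP B \<in> {B \<in> sets borel. B \<subseteq> A}. ennreal (\<nu> B))"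

lemma upper_variation_upper:
  "B \<in> sets borel \<Longrightarrow> B \<subseteq> A \<Longrightarrow> ennreal (\<nu> B) \<le> upper_variation \<nu> A"
  unfolding upper_variation_def by (rule SUP_upper) auto

lemma upper_variation_mono: "A \<subseteq> B \<Longrightarrow> upper_variation \<nu> A \<le> upper_variation \<nu> B"
  unfolding upper_variation_def by (rule SUP_subset_mono) auto

lemma upper_variation_superadditive:
  assumes \<nu>: "finite_signed_measure \<nu>" and disj: "A \<inter> B = {}"
  shows "upper_variation \<nu> A + upper_variation \<nu> B \<le> upper_variation \<nu> (A \<union> B)"
proof -
  let ?S = "\<lambda>A. {B \<in> sets borel. B \<subseteq> A}"
  have ne: "?S A \<noteq> {}" for A :: "real set" by blast
  have two: "ennreal (\<nu> C) + ennreal (\<nu> D) \<le> upper_variation \<nu> (A \<union> B)"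
    if C: "C \<in> ?S A" and D: "D \<in> ?S B" for C D
  proof (cases "0 \<le> \<nu> C \<and> 0 \<le> \<nu> D")
    case True
    have "\<nu> (C \<union> D) = \<nu> C + \<nu> D"
      using C D disj by (intro finite_signed_measure_Un[OF \<nu>]) auto
    then have "ennreal (\<nu> C) + ennreal (\<nu> D) = ennreal (\<nu> (C \<union> D))"
      using True by simp
    also have "\<dots> \<le> upper_variation \<nu> (A \<union> B)"
      using C D by (intro upper_variation_upper) auto
    finally show ?thesis .
  next
    case False
    have "ennreal (\<nu> C) \<le> upper_variation \<nu> (A \<union> B)" "ennreal (\<nu> D) \<le> upper_variation \<nu> (A \<union> B)"
      using C D by (auto intro!: upper_variation_upper)
    with False show ?thesis
      by (cases "0 \<le> \<nu> C") (auto simp: ennreal_neg not_le less_imp_le)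
  qed
  have "upper_variation \<nu> A + upper_variation \<nu> B
      = (SUP C \<in> ?S A. ennreal (\<nu> C) + upper_variation \<nu> B)"
    unfolding upper_variation_def[of \<nu> A] using ne by (rule ennreal_SUP_add_left[symmetric])
  also have "\<dots> \<le> upper_variation \<nu> (A \<union> B)"
  proof (rule SUP_least)
    fix C assume C: "C \<in> ?S A"
    have "ennreal (\<nu> C) + upper_variation \<nu> B
        = (SUP D \<in> ?S B. ennreal (\<nu> C) + ennreal (\<nu> D))"
      unfolding upper_variation_def[of \<nu> B] using ne by (rule ennreal_SUP_add_right)
    also have "\<dots> \<le> upper_variation \<nu> (A \<union> B)"
      using two[OF C] by (rule SUP_least)
    finally show "ennreal (\<nu> C) + upper_variation \<nu> B \<le> upper_variation \<nu> (A \<union> B)" .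
  qed
  finally show ?thesis .
qed

lemma ennreal_sums_le:
  assumes "f sums s"
  shows "ennreal s \<le> (\<Sum>i. ennreal (f i))"
proof -
  have "(\<lambda>n. ennreal (\<Sum>i<n. f i)) \<longlonglongrightarrow> ennreal s"
    using assms by (intro tendsto_ennrealI) (simp add: sums_def)
  moreover have "ennreal (\<Sum>i<n. f i) \<le> (\<Sum>i. ennreal (f i))" for n
  proof -
    have "ennreal (\<Sum>i<n. f i) \<le> ennreal (\<Sum>i<n. max 0 (f i))"
      by (intro ennreal_leI sum_mono) simp
    also have "\<dots> = (\<Sum>i<n. ennreal (f i))"
    proof -
      have "ennreal (max 0 (f i)) = ennreal (f i)" for i
        by (cases "0 \<le> f i") (simp_all add: ennreal_neg)
      then show ?thesis
        using sum_ennreal[of "{..<n}" "\<lambda>i. max 0 (f i)"] by simp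
    qed
    also have "\<dots> \<le> (\<Sum>i. ennreal (f i))" by (rule sum_le_suminf) auto
    finally show ?thesis .
  qed
  ultimately show ?thesis by (intro LIMSEQ_le_const2) auto
qed

lemma upper_variation_countably_additive:
  assumes \<nu>: "finite_signed_measure \<nu>"
  shows "countably_additive (sets borel) (upper_variation \<nu>)"
proof (rule countably_additiveI)
  fix A :: "nat \<Rightarrow> real set"
  assume A: "range A \<subseteq> sets borel" "disjoint_family A" "(\<Union>i. A i) \<in> sets borel"
  have "(\<Sum>i<n. upper_variation \<nu> (A i)) \<le> upper_variation \<nu> (\<Union>i<n. A i)" for n
  proof (induction n)
    case (Suc n)
    have "A i \<inter> A n = {}" if "i < n" for i
      using A(2) that by (intro disjoint_family_onD[of A UNIV]) auto
    then have "(\<Union>i<n. A i) \<inter> A n = {}" by blast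
    then have "upper_variation \<nu> (\<Union>i<n. A i) + upper_variation \<nu> (A n)
        \<le> upper_variation \<nu> ((\<Union>i<n. A i) \<union> A n)"
      by (rule upper_variation_superadditive[OF \<nu>])
    then show ?case
      using order_trans[OF add_right_mono[OF Suc.IH]] by (simp add: lessThan_Suc Un_commute add.commute)
  qed simp
  then have "(\<Sum>i<n. upper_variation \<nu> (A i)) \<le> upper_variation \<nu> (\<Union>i. A i)" for n
    by (rule order_trans) (rule upper_variation_mono, blast)
  then have le: "(\<Sum>i. upper_variation \<nu> (A i)) \<le> upper_variation \<nu> (\<Union>i. A i)"
    by (intro suminf_le_const) auto
  moreover have "upper_variation \<nu> (\<Union>i. A i) \<le> (\<Sum>i. upper_variation \<nu> (A i))"
    unfolding upper_variation_def[of \<nu> "\<Union>i. A i"]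
  proof (rule SUP_least)
    fix B assume "B \<in> {B \<in> sets borel. B \<subseteq> (\<Union>i. A i)}"
    then have B: "B \<in> sets borel" "B = (\<Union>i. B \<inter> A i)" by auto
    have "range (\<lambda>i. B \<inter> A i) \<subseteq> sets borel" "disjoint_family (\<lambda>i. B \<inter> A i)"
      using A B(1) by (auto simp: disjoint_family_on_def)
    then have "(\<lambda>i. \<nu> (B \<inter> A i)) sums \<nu> (\<Union>i. B \<inter> A i)"
      using \<nu> unfolding finite_signed_measure_def by blast
    then have "ennreal (\<nu> B) \<le> (\<Sum>i. ennreal (\<nu> (B \<inter> A i)))"
      using B(2) ennreal_sums_le by metis
    also have "\<dots> \<le> (\<Sum>i. upper_variation \<nu> (A i))"
      using A(1) B(1) by (intro suminf_le upper_variation_upper) auto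
    finally show "ennreal (\<nu> B) \<le> (\<Sum>i. upper_variation \<nu> (A i))" .
  qed
  ultimately show "(\<Sum>i. upper_variation \<nu> (A i)) = upper_variation \<nu> (\<Union>i. A i)"
    by (rule antisym)
qed

lemma sets_pos_variation [simp, measurable_cong]: "sets (pos_variation \<nu>) = sets borel"
proof -
  have "sigma_sets UNIV (sets borel) = sets (borel :: real measure)"
    using sets.sigma_sets_eq[of "borel :: real measure"] by simp
  then show ?thesis unfolding pos_variation_def by (simp add: sets_measure_of)
qed

lemma space_pos_variation [simp]: "space (pos_variation \<nu>) = UNIV"
  unfolding pos_variation_def by (simp add: space_measure_of)

lemma sets_neg_variation [simp, measurable_cong]: "sets (neg_variation \<nu>) = sets borel"
  by (simp add: neg_variation_def)

lemma space_neg_variation [simp]: "space (neg_variation \<nu>) = UNIV"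
  by (simp add: neg_variation_def)

lemma emeasure_pos_variation:
  assumes "finite_signed_measure \<nu>" "A \<in> sets borel"
  shows "emeasure (pos_variation \<nu>) A = upper_variation \<nu> A"
  unfolding pos_variation_def upper_variation_def[symmetric]
proof (rule emeasure_measure_of_sigma)
  show "sigma_algebra UNIV (sets (borel :: real measure))"
    using sets.sigma_algebra_axioms[of "borel :: real measure"] by simp
  have "upper_variation \<nu> {} = 0"
    using assms(1) by (simp add: upper_variation_def finite_signed_measure_def cong: conj_cong)
  then show "positive (sets borel) (upper_variation \<nu>)" by (simp add: positive_def)
qed (use assms upper_variation_countably_additive in auto)

text \<open>
  If the upper variation were infinite, repeatedly splitting a set of infinite upper variation
  would produce a decreasing sequence of sets whose successive differences all have charge at least 1
  in modulus. This contradicts the convergence of the series of the charges of these differences.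
\<close>

lemma emeasure_pos_variation_finite:
  assumes \<nu>: "finite_signed_measure \<nu>"
  shows "emeasure (pos_variation \<nu>) UNIV < \<infinity>"
proof (rule ccontr)
  let ?p = "emeasure (pos_variation \<nu>)"
  assume "\<not> ?p UNIV < \<infinity>"
  then have inf: "?p UNIV = \<infinity>" by (simp add: not_less top_unique)
  have step: "\<exists>E'. (E' \<in> sets borel \<and> ?p E' = \<infinity>) \<and> E' \<subseteq> E \<and> 1 \<le> \<bar>\<nu> (E - E')\<bar>"
    if E: "E \<in> sets borel \<and> ?p E = \<infinity>" for E
  proof -
    have "ennreal (\<bar>\<nu> E\<bar> + 1) < upper_variation \<nu> E"
      using E emeasure_pos_variation[OF \<nu>, of E] by (simp add: ennreal_less_top)
    then obtain A where A: "A \<in> sets borel" "A \<subseteq> E" "ennreal (\<bar>\<nu> E\<bar> + 1) < ennreal (\<nu> A)"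
      unfolding upper_variation_def less_SUP_iff by blast
    then have big: "\<bar>\<nu> E\<bar> + 1 < \<nu> A" by (subst (asm) ennreal_less_iff) auto
    have diff: "\<nu> (E - A) = \<nu> E - \<nu> A" using \<nu> E A by (intro finite_signed_measure_Diff) auto
    have "?p E = ?p A + ?p (E - A)"
    proof -
      have "A \<union> (E - A) = E" using A(2) by auto
      then show ?thesis using E A by (subst plus_emeasure) auto
    qed
    then consider "?p A = \<infinity>" | "?p (E - A) = \<infinity>"
      using E by (metis ennreal_add_eq_top infinity_ennreal_def)
    then show ?thesis
    proof cases
      case 1
      then show ?thesis using A diff big by (intro exI[of _ A]) auto
    next
      case 2
      moreover have "E - (E - A) = A" using A(2) by auto
      ultimately show ?thesis using A E big by (intro exI[of _ "E - A"]) auto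
    qed
  qed
  obtain E where E: "\<And>n. E n \<in> sets borel \<and> ?p (E n) = \<infinity>"
      "\<And>n. E (Suc n) \<subseteq> E n \<and> 1 \<le> \<bar>\<nu> (E n - E (Suc n))\<bar>"
    using dependent_nat_choice[of "\<lambda>_ E. E \<in> sets borel \<and> ?p E = \<infinity>"
        "\<lambda>_ E E'. E' \<subseteq> E \<and> 1 \<le> \<bar>\<nu> (E - E')\<bar>"] inf step
    by (metis space_borel sets.top)
  have dec: "E m \<subseteq> E n" if "n \<le> m" for m n
    by (rule lift_Suc_antimono_le[of E]) (use that E(2) in auto)
  let ?D = "\<lambda>n. E n - E (Suc n)"
  have "?D m \<inter> ?D n = {}" if "m < n" for m n
    using dec[of "Suc m" n] that by auto
  then have "disjoint_family ?D"
    unfolding disjoint_family_on_def by (metis inf_commute linorder_neqE_nat)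
  moreover have "range ?D \<subseteq> sets borel" using E(1) by auto
  ultimately have "(\<lambda>n. \<nu> (?D n)) sums \<nu> (\<Union>n. ?D n)"
    using \<nu> unfolding finite_signed_measure_def by blast
  then have "(\<lambda>n. \<nu> (?D n)) \<longlonglongrightarrow> 0"
    using sums_summable summable_LIMSEQ_zero by blast
  then have "\<forall>\<^sub>F n in sequentially. \<bar>\<nu> (?D n)\<bar> < 1"
    by (simp add: tendsto_iff dist_real_def)
  then show False
    using E(2) by (auto simp: eventually_sequentially not_less[symmetric])
qed

lemma finite_measure_pos_variation:
  "finite_signed_measure \<nu> \<Longrightarrow> finite_measure (pos_variation \<nu>)"
  using emeasure_pos_variation_finite[of \<nu>] by (intro finite_measureI) auto

lemma finite_measure_neg_variation:
  "finite_signed_measure \<nu> \<Longrightarrow> finite_measure (neg_variation \<nu>)"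
  unfolding neg_variation_def by (intro finite_measure_pos_variation finite_signed_measure_uminus)

text \<open>
  Every \<open>B \<subseteq> A\<close> satisfies \<open>\<nu> B = \<nu> A + (- \<nu> (A - B))\<close>, and the second term is at most the negative
  variation of \<open>A\<close>. Applied to \<open>\<nu>\<close> and to \<open>- \<nu>\<close> this gives the Jordan decomposition.
\<close>

lemma measure_pos_variation_le:
  assumes \<nu>: "finite_signed_measure \<nu>" and A: "A \<in> sets borel"
  shows "measure (pos_variation \<nu>) A \<le> \<nu> A + measure (neg_variation \<nu>) A"
proof -
  interpret N: finite_measure "neg_variation \<nu>" by (rule finite_measure_neg_variation[OF \<nu>])
  have le: "\<nu> B \<le> \<nu> A + measure (neg_variation \<nu>) A" if B: "B \<in> sets borel" "B \<subseteq> A" for B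
  proof -
    have "ennreal (- \<nu> (A - B)) \<le> emeasure (neg_variation \<nu>) A"
      unfolding neg_variation_def
      using A B by (subst emeasure_pos_variation[OF finite_signed_measure_uminus[OF \<nu>]])
        (auto intro!: upper_variation_upper[where \<nu> = "\<lambda>A. - \<nu> A"])
    then have "- \<nu> (A - B) \<le> measure (neg_variation \<nu>) A"
      by (simp add: N.emeasure_eq_measure)
    then show ?thesis using finite_signed_measure_Diff[OF \<nu> A B] by simp
  qed
  have "0 \<le> \<nu> A + measure (neg_variation \<nu>) A"
    using le[of "{}"] \<nu> by (simp add: finite_signed_measure_def)
  moreover have "upper_variation \<nu> A \<le> ennreal (\<nu> A + measure (neg_variation \<nu>) A)"
    unfolding upper_variation_def using le by (intro SUP_least ennreal_leI) auto
  ultimately show ?thesis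
    using emeasure_pos_variation[OF \<nu> A]
      finite_measure.emeasure_eq_measure[OF finite_measure_pos_variation[OF \<nu>], of A]
    by (metis ennreal_le_iff)
qed

lemma jordan_decomposition:
  assumes \<nu>: "finite_signed_measure \<nu>" and A: "A \<in> sets borel"
  shows "\<nu> A = measure (pos_variation \<nu>) A - measure (neg_variation \<nu>) A"
  using measure_pos_variation_le[OF \<nu> A] measure_pos_variation_le[OF finite_signed_measure_uminus[OF \<nu>] A]
  by (simp add: neg_variation_uminus neg_variation_def)

lemma integrable_variation:
  fixes \<phi> :: "real \<Rightarrow> real"
  assumes \<nu>: "finite_signed_measure \<nu>" and "\<phi> \<in> borel_measurable borel" "\<And>t. \<bar>\<phi> t\<bar> \<le> B"
  shows "integrable (pos_variation \<nu>) \<phi>" "integrable (neg_variation \<nu>) \<phi>"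
proof -
  have m: "\<phi> \<in> borel_measurable (pos_variation \<nu>)" "\<phi> \<in> borel_measurable (neg_variation \<nu>)"
    using assms(2) by (simp_all cong: measurable_cong_sets)
  show "integrable (pos_variation \<nu>) \<phi>"
    by (rule finite_measure.integrable_const_bound[OF finite_measure_pos_variation[OF \<nu>] _ m(1), of B])
      (use assms(3) in simp)
  show "integrable (neg_variation \<nu>) \<phi>"
    by (rule finite_measure.integrable_const_bound[OF finite_measure_neg_variation[OF \<nu>] _ m(2), of B])
      (use assms(3) in simp)
qed

lemma signed_integral_add:
  assumes "finite_signed_measure \<nu>"
    and "\<phi> \<in> borel_measurable borel" "\<And>t. \<bar>\<phi> t\<bar> \<le> B"
    and "\<psi> \<in> borel_measurable borel" "\<And>t. \<bar>\<psi> t\<bar> \<le> C"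
  shows "signed_integral \<nu> (\<lambda>t. \<phi> t + \<psi> t) = signed_integral \<nu> \<phi> + signed_integral \<nu> \<psi>"
  unfolding signed_integral_def
  using integrable_variation[OF assms(1-3)] integrable_variation[OF assms(1,4,5)] by simp

lemma signed_integral_scale: "signed_integral \<nu> (\<lambda>t. c * \<phi> t) = c * signed_integral \<nu> \<phi>"
  unfolding signed_integral_def by (simp add: algebra_simps)

lemma signed_integral_sum:
  assumes "finite_signed_measure \<nu>" "finite I"
    and "\<And>i. i \<in> I \<Longrightarrow> \<phi> i \<in> borel_measurable borel" "\<And>i t. i \<in> I \<Longrightarrow> \<bar>\<phi> i t\<bar> \<le> B"
  shows "signed_integral \<nu> (\<lambda>t. \<Sum>i\<in>I. \<phi> i t) = (\<Sum>i\<in>I. signed_integral \<nu> (\<phi> i))"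
proof -
  have "integrable (pos_variation \<nu>) (\<phi> i)" "integrable (neg_variation \<nu>) (\<phi> i)" if "i \<in> I" for i
    using integrable_variation[OF assms(1,3,4)] that by blast+
  then show ?thesis
    unfolding signed_integral_def by (simp add: Bochner_Integration.integral_sum sum_subtractf)
qed

lemma signed_integral_indicator:
  assumes "finite_signed_measure \<nu>" "A \<in> sets borel"
  shows "signed_integral \<nu> (indicator A) = \<nu> A"
  using assms by (simp add: signed_integral_def jordan_decomposition)

lemma abs_signed_integral_le_tv_norm:
  assumes \<nu>: "finite_signed_measure \<nu>" and \<phi>: "\<phi> \<in> borel_measurable borel" "\<And>t. \<bar>\<phi> t\<bar> \<le> 1"
  shows "\<bar>signed_integral \<nu> \<phi>\<bar> \<le> tv_norm \<nu>"
proof -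
  interpret P: finite_measure "pos_variation \<nu>" by (rule finite_measure_pos_variation[OF \<nu>])
  interpret N: finite_measure "neg_variation \<nu>" by (rule finite_measure_neg_variation[OF \<nu>])
  have "\<bar>integral\<^sup>L (pos_variation \<nu>) \<phi>\<bar> \<le> integral\<^sup>L (pos_variation \<nu>) (\<lambda>_. 1)"
    using integrable_variation[OF \<nu> \<phi>] \<phi>(2)
    by (intro order_trans[OF integral_abs_bound] integral_mono) (auto intro: integrable_abs)
  moreover have "\<bar>integral\<^sup>L (neg_variation \<nu>) \<phi>\<bar> \<le> integral\<^sup>L (neg_variation \<nu>) (\<lambda>_. 1)"
    using integrable_variation[OF \<nu> \<phi>] \<phi>(2)
    by (intro order_trans[OF integral_abs_bound] integral_mono) (auto intro: integrable_abs)
  ultimately show ?thesis by (simp add: signed_integral_def tv_norm_def)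
qed

lemma signed_integral_tendsto:
  assumes \<nu>: "finite_signed_measure \<nu>"
    and \<phi>: "\<And>n. \<phi> n \<in> borel_measurable borel" "\<And>n t. \<bar>\<phi> n t\<bar> \<le> B"
    and lim: "\<And>t. (\<lambda>n. \<phi> n t) \<longlonglongrightarrow> \<psi> t" and \<psi>: "\<psi> \<in> borel_measurable borel"
  shows "(\<lambda>n. signed_integral \<nu> (\<phi> n)) \<longlonglongrightarrow> signed_integral \<nu> \<psi>"
proof -
  interpret P: finite_measure "pos_variation \<nu>" by (rule finite_measure_pos_variation[OF \<nu>])
  interpret N: finite_measure "neg_variation \<nu>" by (rule finite_measure_neg_variation[OF \<nu>])
  show ?thesis
    unfolding signed_integral_def using assms
    by (intro tendsto_diff integral_dominated_convergence[where w = "\<lambda>_. B"])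
      (auto cong: measurable_cong_sets)
qed

lemma finite_signed_measure_dirac_sum:
  assumes "finite T"
  shows "finite_signed_measure (\<lambda>A. \<Sum>\<tau>\<in>T. a \<tau> * dirac \<tau> A)"
proof -
  have "(\<lambda>n. dirac \<tau> (A n)) sums dirac \<tau> (\<Union>n. A n)"
    if A: "range A \<subseteq> sets borel" "disjoint_family A" for A :: "nat \<Rightarrow> real set" and \<tau>
  proof -
    have U: "(\<Union>n. A n) \<in> sets borel" using A(1) by auto
    show ?thesis
    proof (cases "\<tau> \<in> (\<Union>n. A n)")
      case True
      then obtain k where k: "\<tau> \<in> A k" by auto
      then have "dirac \<tau> (A n) = (if n = k then 1 else 0)" for n
        using A unfolding dirac_def disjoint_family_on_def by auto
      then show ?thesis
        using sums_single[of k "\<lambda>_. 1 :: real"] U True by (simp add: dirac_def)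
    next
      case False
      then show ?thesis by (simp add: dirac_def)
    qed
  qed
  then show ?thesis
    using assms unfolding finite_signed_measure_def
    by (auto intro!: sums_sum sums_mult sum.neutral simp: dirac_def)
qed

text \<open>
  Both parts of the Jordan decomposition vanish off the support, so integrals against them
  are finite sums over the atoms.
\<close>

lemma signed_integral_dirac_sum:
  assumes T: "finite T" and \<phi>: "\<phi> \<in> borel_measurable borel"
  shows "signed_integral (\<lambda>A. \<Sum>\<tau>\<in>T. a \<tau> * dirac \<tau> A) \<phi> = (\<Sum>\<tau>\<in>T. a \<tau> * \<phi> \<tau>)"
    and "tv_norm (\<lambda>A. \<Sum>\<tau>\<in>T. a \<tau> * dirac \<tau> A) = (\<Sum>\<tau>\<in>T. \<bar>a \<tau>\<bar>)"
proof -
  define \<nu> where "\<nu> = (\<lambda>a A. \<Sum>\<tau>\<in>T. a \<tau> * dirac \<tau> A)"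
  have fsm: "finite_signed_measure (\<nu> a)" for a
    unfolding \<nu>_def using T by (rule finite_signed_measure_dirac_sum)
  have neg: "neg_variation (\<nu> a) = pos_variation (\<nu> (\<lambda>\<tau>. - a \<tau>))" for a
    by (simp add: neg_variation_def \<nu>_def sum_negf)
  have Tb: "T \<in> sets borel" using T by (simp add: finite_imp_closed)
  have sub: "\<nu> a B = (\<Sum>\<tau>\<in>T \<inter> B. a \<tau>)" if "B \<in> sets borel" for a B
    using T that by (simp add: \<nu>_def dirac_def sum.inter_restrict of_bool_def if_distrib cong: if_cong)
  have atom: "measure (pos_variation (\<nu> a)) {\<tau>} = max 0 (a \<tau>)" if "\<tau> \<in> T" for a \<tau>
  proof -
    have "{B \<in> sets borel. B \<subseteq> {\<tau>}} = {{}, {\<tau>}}" by auto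
    then have "upper_variation (\<nu> a) {\<tau>} = ennreal (a \<tau>)"
      using that by (simp add: upper_variation_def sub sup_absorb2)
    then show ?thesis
      by (simp add: measure_def emeasure_pos_variation[OF fsm] max_def ennreal_neg)
  qed
  have off: "emeasure (pos_variation (\<nu> a)) (UNIV - T) = 0" for a
  proof -
    have "upper_variation (\<nu> a) (UNIV - T) \<le> 0"
      unfolding upper_variation_def
    proof (rule SUP_least)
      fix B assume B: "B \<in> {B \<in> sets borel. B \<subseteq> UNIV - T}"
      then have "T \<inter> B = {}" by auto
      then show "ennreal (\<nu> a B) \<le> 0" using B sub[of B a] by simp
    qed
    then show ?thesis using Tb by (subst emeasure_pos_variation[OF fsm]) auto
  qed
  have int: "integral\<^sup>L (pos_variation (\<nu> a)) \<psi> = (\<Sum>\<tau>\<in>T. max 0 (a \<tau>) * \<psi> \<tau>)"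
    if \<psi>: "\<psi> \<in> borel_measurable borel" for a and \<psi> :: "real \<Rightarrow> real"
  proof -
    interpret P: finite_measure "pos_variation (\<nu> a)" by (rule finite_measure_pos_variation[OF fsm])
    have "AE t in pos_variation (\<nu> a). t \<in> T"
      using off Tb by (intro AE_I[of _ _ "UNIV - T"]) auto
    then have "AE t in pos_variation (\<nu> a). \<psi> t = (\<Sum>\<tau>\<in>T. \<psi> \<tau> * indicator {\<tau>} t)"
      using T by (auto simp: indicator_def of_bool_def if_distrib[of "\<lambda>x. _ * x"] cong: if_cong
          elim!: eventually_mono)
    then have "integral\<^sup>L (pos_variation (\<nu> a)) \<psi>
        = integral\<^sup>L (pos_variation (\<nu> a)) (\<lambda>t. \<Sum>\<tau>\<in>T. \<psi> \<tau> * indicator {\<tau>} t)"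
      using \<psi> by (intro integral_cong_AE) (auto cong: measurable_cong_sets)
    also have "\<dots> = (\<Sum>\<tau>\<in>T. \<psi> \<tau> * measure (pos_variation (\<nu> a)) {\<tau>})"
      by (subst Bochner_Integration.integral_sum) (auto simp: P.emeasure_eq_measure)
    finally show ?thesis by (simp add: atom mult.commute)
  qed
  have "signed_integral (\<nu> a) \<phi> = (\<Sum>\<tau>\<in>T. a \<tau> * \<phi> \<tau>)"
    unfolding signed_integral_def neg int[OF \<phi>] sum_subtractf[symmetric]
    by (intro sum.cong) (auto simp: max_def)
  then show "signed_integral (\<lambda>A. \<Sum>\<tau>\<in>T. a \<tau> * dirac \<tau> A) \<phi> = (\<Sum>\<tau>\<in>T. a \<tau> * \<phi> \<tau>)"
    unfolding \<nu>_def .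
  have "measure (pos_variation (\<nu> a)) UNIV = (\<Sum>\<tau>\<in>T. max 0 (a \<tau>))" for a
    using int[of "\<lambda>_. 1" a] by simp
  then have "tv_norm (\<nu> a) = (\<Sum>\<tau>\<in>T. \<bar>a \<tau>\<bar>)"
    unfolding tv_norm_def neg
    by (simp add: sum.distrib[symmetric]) (intro sum.cong, auto simp: max_def)
  then show "tv_norm (\<lambda>A. \<Sum>\<tau>\<in>T. a \<tau> * dirac \<tau> A) = (\<Sum>\<tau>\<in>T. \<bar>a \<tau>\<bar>)"
    unfolding \<nu>_def .
qed

section \<open>Schwartz functions\<close>

lemma schwartz_DERIV:
  assumes "\<phi> \<in> schwartz"
  shows "((deriv ^^ n) \<phi> has_real_derivative (deriv ^^ Suc n) \<phi> t) (at t)"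
  using assms by (simp add: schwartz_def DERIV_deriv_iff_real_differentiable)

lemma schwartz_deriv:
  assumes "\<phi> \<in> schwartz"
  shows "deriv \<phi> \<in> schwartz"
proof -
  have "(deriv ^^ n) (deriv \<phi>) = (deriv ^^ Suc n) \<phi>" for n
    by (simp add: funpow_swap1)
  moreover have "(deriv ^^ Suc n) \<phi> differentiable (at t)"
      "bounded (range (\<lambda>t. t ^ k * (deriv ^^ Suc n) \<phi> t))" for n t k
    using assms unfolding schwartz_def by blast+
  ultimately show ?thesis unfolding schwartz_def by simp
qed

lemma continuous_on_schwartz:
  assumes "\<phi> \<in> schwartz"
  shows "continuous_on S \<phi>"
  using schwartz_DERIV[OF assms, of 0]
  by (auto intro!: continuous_at_imp_continuous_on DERIV_isCont)

lemma schwartzI: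
  assumes F: "\<And>n t. (F n has_real_derivative F (Suc n) t) (at t)"
    and bd: "\<And>k n. bounded (range (\<lambda>t. t ^ k * F n t))"
  shows "F 0 \<in> schwartz"
proof -
  have "(deriv ^^ n) (F 0) = F n" for n
    by (induction n) (auto intro!: ext DERIV_imp_deriv F)
  then show ?thesis
    using F bd unfolding schwartz_def by (auto simp: real_differentiable_def)
qed

lemma schwartz_antiderivative:
  assumes "\<psi> \<in> schwartz" "\<And>t. (\<phi> has_real_derivative \<psi> t) (at t)"
    and "\<And>k. bounded (range (\<lambda>t. t ^ k * \<phi> t))"
  shows "\<phi> \<in> schwartz"
proof -
  define F where "F = case_nat \<phi> (\<lambda>n. (deriv ^^ n) \<psi>)"
  have "F 0 \<in> schwartz"
  proof (rule schwartzI)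
    show "(F n has_real_derivative F (Suc n) t) (at t)" for n t
      using assms(2) schwartz_DERIV[OF assms(1)] by (cases n) (simp_all add: F_def)
    show "bounded (range (\<lambda>t. t ^ k * F n t))" for k n
      using assms(1,3) by (cases n) (simp_all add: F_def schwartz_def)
  qed
  then show ?thesis by (simp add: F_def)
qed

lemma schwartz_add:
  assumes "\<phi> \<in> schwartz" "\<psi> \<in> schwartz"
  shows "(\<lambda>t. \<phi> t + \<psi> t) \<in> schwartz"
proof -
  let ?F = "\<lambda>n t. (deriv ^^ n) \<phi> t + (deriv ^^ n) \<psi> t"
  have "?F 0 \<in> schwartz"
  proof (rule schwartzI)
    show "(?F n has_real_derivative ?F (Suc n) t) (at t)" for n t
      by (intro DERIV_add schwartz_DERIV assms)
    show "bounded (range (\<lambda>t. t ^ k * ?F n t))" for k n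
      unfolding distrib_left using assms by (intro bounded_plus_comp) (simp_all add: schwartz_def)
  qed
  then show ?thesis by simp
qed

lemma schwartz_cmult:
  assumes "\<phi> \<in> schwartz"
  shows "(\<lambda>t. c * \<phi> t) \<in> schwartz"
proof -
  let ?F = "\<lambda>n t. c * (deriv ^^ n) \<phi> t"
  have "?F 0 \<in> schwartz"
  proof (rule schwartzI)
    show "(?F n has_real_derivative ?F (Suc n) t) (at t)" for n t
      by (intro DERIV_cmult schwartz_DERIV assms)
    show "bounded (range (\<lambda>t. t ^ k * ?F n t))" for k n
    proof -
      have "bounded (range (\<lambda>t. t ^ k * (deriv ^^ n) \<phi> t))"
        using assms unfolding schwartz_def by blast
      from bounded_scaling[OF this, of c] show ?thesis
        by (simp add: image_image mult.left_commute)
    qed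
  qed
  then show ?thesis by simp
qed

text \<open>
  All test functions constructed below decay exponentially together with their derivatives, so this is the only
  decay estimate they need.
\<close>

lemma bounded_power_times_exp_decay:
  fixes g :: "real \<Rightarrow> real"
  assumes c: "c > 0" and g: "\<And>t. \<bar>g t\<bar> \<le> C * exp (- c * \<bar>t\<bar>)"
  shows "bounded (range (\<lambda>t. t ^ k * g t))"
proof -
  have pow: "\<bar>t\<bar> ^ k \<le> (k / c) ^ k * exp (c * \<bar>t\<bar>)" for t :: real
  proof (cases "k = 0")
    case False
    have "(c * \<bar>t\<bar> / k) ^ k \<le> (1 + c * \<bar>t\<bar> / k) ^ k"
      using c by (intro power_mono) auto
    also have "\<dots> \<le> exp (c * \<bar>t\<bar>)"
      using c False by (intro exp_ge_one_plus_x_over_n_power_n) (auto intro: order_trans[of _ 0])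
    finally have "(k / c) ^ k * (c * \<bar>t\<bar> / k) ^ k \<le> (k / c) ^ k * exp (c * \<bar>t\<bar>)"
      using c by (intro mult_left_mono) auto
    moreover have "(k / c) ^ k * (c * \<bar>t\<bar> / k) ^ k = \<bar>t\<bar> ^ k"
      using c False by (simp add: power_mult_distrib[symmetric])
    ultimately show ?thesis by simp
  qed (use c in simp)
  have "norm (t ^ k * g t) \<le> (k / c) ^ k * C" for t
  proof -
    have "norm (t ^ k * g t) \<le> ((k / c) ^ k * exp (c * \<bar>t\<bar>)) * (C * exp (- c * \<bar>t\<bar>))"
      using pow[of t] g[of t] c unfolding real_norm_def abs_mult power_abs by (intro mult_mono) auto
    also have "\<dots> = (k / c) ^ k * C * (exp (c * \<bar>t\<bar>) * exp (- c * \<bar>t\<bar>))" by simp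
    also have "\<dots> = (k / c) ^ k * C" by (simp add: exp_add[symmetric])
    finally show ?thesis .
  qed
  then show ?thesis by (auto simp: bounded_iff)
qed

section \<open>The logistic kernel\<close>

definition logistic :: "real \<Rightarrow> real" where
  "logistic u = 1 / (1 + exp (- u))"

lemma logistic_pos: "0 < logistic u" and logistic_less_1: "logistic u < 1"
  by (simp_all add: logistic_def add_pos_pos)

lemma logistic_minus: "logistic (- u) = 1 - logistic u"
proof -
  have "1 + exp u > 0" "1 + exp (- u) > 0" by (simp_all add: add_pos_pos)
  then show ?thesis by (simp add: logistic_def exp_minus field_simps)
qed

lemma logistic_le_exp: "logistic u \<le> exp u"
  by (simp add: logistic_def field_simps exp_minus add_pos_pos)

lemma DERIV_logistic: "(logistic has_real_derivative logistic u * (1 - logistic u)) (at u)"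
proof -
  have "1 + exp (- u) > 0" by (simp add: add_pos_pos)
  then show ?thesis
    unfolding logistic_def by (auto intro!: derivative_eq_intros simp: field_simps power2_eq_square)
qed

lemma logistic_density_bounds:
  "exp (- \<bar>u\<bar>) / 4 \<le> logistic u * (1 - logistic u)"
  "logistic u * (1 - logistic u) \<le> exp (- \<bar>u\<bar>)"
proof -
  have eq: "logistic u * (1 - logistic u) = 1 / (2 + exp u + exp (- u))"
  proof -
    have "(1 + exp u) * (1 + exp (- u)) = 2 + exp u + exp (- u)"
      by (simp add: algebra_simps exp_minus)
    moreover have "logistic u * logistic (- u) = 1 / ((1 + exp u) * (1 + exp (- u)))"
      by (simp add: logistic_def)
    ultimately show ?thesis by (simp add: logistic_minus)
  qed
  have "2 + exp u + exp (- u) \<le> 4 * exp \<bar>u\<bar>"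
    using one_le_exp_iff[of "\<bar>u\<bar>"] exp_le_cancel_iff[of u "\<bar>u\<bar>"] exp_le_cancel_iff[of "- u" "\<bar>u\<bar>"]
    by linarith
  then have "1 / (4 * exp \<bar>u\<bar>) \<le> 1 / (2 + exp u + exp (- u))"
    by (intro divide_left_mono) (auto intro!: mult_pos_pos add_pos_pos)
  then show "exp (- \<bar>u\<bar>) / 4 \<le> logistic u * (1 - logistic u)"
    unfolding eq by (simp add: exp_minus field_simps)
  have "exp \<bar>u\<bar> \<le> 2 + exp u + exp (- u)"
    using exp_gt_zero[of u] exp_gt_zero[of "- u"] by (cases "0 \<le> u") (simp_all del: exp_gt_zero)
  then have "1 / (2 + exp u + exp (- u)) \<le> 1 / exp \<bar>u\<bar>"
    by (intro divide_left_mono) (auto intro!: mult_pos_pos add_pos_pos)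
  then show "logistic u * (1 - logistic u) \<le> exp (- \<bar>u\<bar>)"
    unfolding eq by (simp add: exp_minus field_simps)
qed

definition logistic_kernel :: "real \<Rightarrow> real \<Rightarrow> real" where
  "logistic_kernel \<kappa> u = \<kappa> * (logistic (\<kappa> * u) * (1 - logistic (\<kappa> * u)))"

lemma logistic_kernel_nonneg: "\<kappa> > 0 \<Longrightarrow> 0 \<le> logistic_kernel \<kappa> u"
  unfolding logistic_kernel_def using logistic_pos[of "\<kappa> * u"] logistic_less_1[of "\<kappa> * u"] by simp

lemma DERIV_logistic_scaled:
  "((\<lambda>t. logistic (\<kappa> * (t - x))) has_real_derivative logistic_kernel \<kappa> (t - x)) (at t)"
  unfolding logistic_kernel_def
  by (rule DERIV_cong, rule DERIV_chain2[OF DERIV_logistic]) (auto intro!: derivative_eq_intros)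

lemma isCont_logistic_kernel: "isCont (\<lambda>t. logistic_kernel \<kappa> (t - x)) t"
proof -
  have "isCont (\<lambda>t. logistic (\<kappa> * (t - x))) t"
    using DERIV_logistic_scaled by (rule DERIV_isCont)
  then show ?thesis unfolding logistic_kernel_def by (intro continuous_intros)
qed

text \<open>
  The logistic function solves \<open>\<sigma>' = \<sigma> (1 - \<sigma>)\<close>, so every derivative of the kernel is
  \<open>\<sigma> (1 - \<sigma>)\<close> times a polynomial in \<open>\<sigma>\<close>. Such a polynomial is bounded because \<open>\<sigma>\<close> takes values
  in \<open>[0, 1]\<close>, and all derivatives inherit the exponential decay of \<open>\<sigma> (1 - \<sigma>)\<close>.
\<close>

lemma schwartz_logistic_kernel:
  assumes \<kappa>: "\<kappa> > 0"
  shows "(\<lambda>t. logistic_kernel \<kappa> (t - x)) \<in> schwartz"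
proof -
  define w :: "real poly" where "w = [:0, 1, -1:]"
  \<comment> \<open>\<open>R n * w\<close>, evaluated at \<open>\<sigma>\<close>, is the \<open>n\<close>-th derivative of \<open>\<sigma> (1 - \<sigma>)\<close>\<close>
  define R :: "nat \<Rightarrow> real poly" where "R = rec_nat 1 (\<lambda>_ r. pderiv (r * w))"
  have R: "R 0 = 1" "R (Suc n) = pderiv (R n * w)" for n by (simp_all add: R_def)
  have w: "poly w v = v * (1 - v)" for v by (simp add: w_def algebra_simps)
  define F where "F = (\<lambda>n t. \<kappa> ^ Suc n * poly (R n * w) (logistic (\<kappa> * (t - x))))"
  have "F 0 \<in> schwartz"
  proof (rule schwartzI)
    fix n t
    show "(F n has_real_derivative F (Suc n) t) (at t)"
      unfolding F_def
      by (rule DERIV_cong, rule DERIV_cmult, rule DERIV_chain2[OF poly_DERIV DERIV_logistic_scaled])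
        (simp add: logistic_kernel_def R w)
  next
    fix k n
    have "bounded (poly (R n) ` {0..1})"
      by (intro compact_imp_bounded compact_continuous_image continuous_intros compact_Icc)
    then obtain B where B: "\<And>v. v \<in> {0..1} \<Longrightarrow> \<bar>poly (R n) v\<bar> \<le> B" "B > 0"
      unfolding bounded_pos by (metis image_eqI real_norm_def)
    show "bounded (range (\<lambda>t. t ^ k * F n t))"
    proof (rule bounded_power_times_exp_decay[OF \<kappa>])
      fix t
      define u where "u = \<kappa> * (t - x)"
      have lg: "0 \<le> logistic u" "logistic u \<le> 1"
        using logistic_pos[of u] logistic_less_1[of u] by auto
      have "\<kappa> * \<bar>t\<bar> - \<kappa> * \<bar>x\<bar> \<le> \<bar>u\<bar>"
        using \<kappa> by (simp add: u_def abs_mult right_diff_distrib[symmetric])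
      then have "exp (- \<bar>u\<bar>) \<le> exp (\<kappa> * \<bar>x\<bar>) * exp (- \<kappa> * \<bar>t\<bar>)"
        by (simp add: exp_add[symmetric])
      then have d: "logistic u * (1 - logistic u) \<le> exp (\<kappa> * \<bar>x\<bar>) * exp (- \<kappa> * \<bar>t\<bar>)"
        using logistic_density_bounds(2)[of u] by linarith
      have "\<bar>F n t\<bar> = \<kappa> ^ Suc n * (\<bar>poly (R n) (logistic u)\<bar> * (logistic u * (1 - logistic u)))"
        using \<kappa> lg by (simp add: F_def w abs_mult u_def[symmetric])
      also have "\<dots> \<le> \<kappa> ^ Suc n * (B * (exp (\<kappa> * \<bar>x\<bar>) * exp (- \<kappa> * \<bar>t\<bar>)))"
        using \<kappa> lg B by (intro mult_left_mono mult_mono d) auto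
      finally show "\<bar>F n t\<bar> \<le> (\<kappa> ^ Suc n * B * exp (\<kappa> * \<bar>x\<bar>)) * exp (- \<kappa> * \<bar>t\<bar>)"
        by (simp add: mult_ac)
    qed
  qed
  then show ?thesis by (simp add: F_def R w logistic_kernel_def)
qed

lemma tendsto_logistic_at_top: "(logistic \<longlongrightarrow> 1) at_top"
proof -
  have "((\<lambda>u. 1 / (1 + exp (- u))) \<longlongrightarrow> 1 / (1 + 0)) (at_top :: real filter)"
    by (intro tendsto_intros filterlim_compose[OF exp_at_bot] filterlim_uminus_at_bot_at_top) simp
  then show ?thesis by (simp add: logistic_def[abs_def])
qed

lemma tendsto_logistic_at_bot: "(logistic \<longlongrightarrow> 0) at_bot"
proof -
  have "((\<lambda>u. 1 - logistic (- u)) \<longlongrightarrow> 1 - 1) at_bot"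
    by (intro tendsto_intros filterlim_compose[OF tendsto_logistic_at_top] filterlim_uminus_at_top_at_bot)
  then show ?thesis by (simp add: logistic_minus)
qed

lemma has_bochner_integral_logistic_kernel:
  assumes \<kappa>: "\<kappa> > 0"
  shows "has_bochner_integral lborel (\<lambda>t. logistic_kernel \<kappa> (t - x)) 1"
proof -
  let ?F = "\<lambda>t. logistic (\<kappa> * (t - x))"
  have top: "filterlim (\<lambda>t. \<kappa> * (t - x)) at_top at_top"
    using \<kappa> by real_asymp
  have bot: "filterlim (\<lambda>t. \<kappa> * (t - x)) at_bot at_bot"
    using \<kappa> by real_asymp
  have A: "((?F \<circ> real_of_ereal) \<longlongrightarrow> 0) (at_right (- \<infinity>))"
    unfolding at_right_MInf comp_def filterlim_filtermap
    by (simp add: filterlim_compose[OF tendsto_logistic_at_bot bot])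
  have B: "((?F \<circ> real_of_ereal) \<longlongrightarrow> 1) (at_left \<infinity>)"
    unfolding at_left_PInf comp_def filterlim_filtermap
    by (simp add: filterlim_compose[OF tendsto_logistic_at_top top])
  note FTC = interval_integral_FTC_nonneg[of "-\<infinity>" "\<infinity>" ?F "\<lambda>t. logistic_kernel \<kappa> (t - x)", OF _
      DERIV_logistic_scaled isCont_logistic_kernel _ A B]
  have "set_integrable lborel (einterval (-\<infinity>) \<infinity>) (\<lambda>t. logistic_kernel \<kappa> (t - x))"
    by (rule FTC(1)) (use logistic_kernel_nonneg[OF \<kappa>] in auto)
  moreover have "(LBINT t=-\<infinity>..\<infinity>. logistic_kernel \<kappa> (t - x)) = 1 - 0"
    by (rule FTC(2)) (use logistic_kernel_nonneg[OF \<kappa>] in auto)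
  ultimately show ?thesis
    by (simp add: has_bochner_integral_iff set_integrable_def interval_lebesgue_integral_def
        set_lebesgue_integral_def einterval_def)
qed

text \<open>
  Only the local behaviour of \<open>f\<close> is controlled, not its growth. Near \<open>x\<close>
  continuity suffices. Away from \<open>x\<close> the kernel of scale \<open>\<kappa>\<close> is a vanishing multiple of the kernel of
  scale 1, against which \<open>f\<close> is integrable.
\<close>

lemma logistic_kernel_approximate_identity:
  assumes cont: "isCont f x"
    and int: "\<And>\<kappa>. \<kappa> > 0 \<Longrightarrow> integrable lborel (\<lambda>t. f t * logistic_kernel \<kappa> (t - x))"
  shows "(\<lambda>n. integral\<^sup>L lborel (\<lambda>t. f t * logistic_kernel (real (Suc n)) (t - x))) \<longlonglongrightarrow> f x"
proof -
  define g where "g = (\<lambda>t. f t - f x)"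
  note K = has_bochner_integral_logistic_kernel[unfolded has_bochner_integral_iff]
  have intg: "integrable lborel (\<lambda>t. g t * logistic_kernel \<kappa> (t - x))" if "\<kappa> > 0" for \<kappa>
    unfolding g_def left_diff_distrib using int[OF that] K[OF that] by auto
  have shift: "integral\<^sup>L lborel (\<lambda>t. f t * logistic_kernel \<kappa> (t - x)) - f x
      = integral\<^sup>L lborel (\<lambda>t. g t * logistic_kernel \<kappa> (t - x))" if "\<kappa> > 0" for \<kappa>
    unfolding g_def left_diff_distrib using int[OF that] K[OF that] by simp
  define I where "I = integral\<^sup>L lborel (\<lambda>t. \<bar>g t\<bar> * logistic_kernel 1 (t - x))"
  have lim: "(\<lambda>n. integral\<^sup>L lborel (\<lambda>t. g t * logistic_kernel (real (Suc n)) (t - x))) \<longlonglongrightarrow> 0"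
  proof (rule LIMSEQ_I)
    fix e :: real assume e: "e > 0"
    then obtain \<delta> where \<delta>: "\<delta> > 0" "\<And>t. \<bar>t - x\<bar> < \<delta> \<Longrightarrow> \<bar>g t\<bar> < e / 2"
      using cont unfolding isCont_def LIM_eq g_def by (metis abs_zero diff_self half_gt_zero real_norm_def)
    \<comment> \<open>the ratio of the kernels of scale \<open>n + 1\<close> and 1 is at most \<open>C n\<close> off the \<open>\<delta>\<close>-neighbourhood of \<open>x\<close>\<close>
    define C where "C = (\<lambda>n. 4 * real (Suc n) * exp (- real n * \<delta>))"
    have bound: "\<bar>integral\<^sup>L lborel (\<lambda>t. g t * logistic_kernel (real (Suc n)) (t - x))\<bar> \<le> e / 2 + C n * I"
      for n
    proof -
      have pt: "\<bar>g t * logistic_kernel (real (Suc n)) (t - x)\<bar>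
          \<le> (e / 2) * logistic_kernel (real (Suc n)) (t - x) + C n * (\<bar>g t\<bar> * logistic_kernel 1 (t - x))" for t
      proof (cases "\<bar>t - x\<bar> < \<delta>")
        case True
        have "\<bar>g t * logistic_kernel (real (Suc n)) (t - x)\<bar> \<le> (e / 2) * logistic_kernel (real (Suc n)) (t - x)"
          using \<delta>(2)[OF True] logistic_kernel_nonneg[of "real (Suc n)" "t - x"]
          by (simp add: abs_mult) (metis less_imp_le mult.assoc mult.commute mult_right_mono)
        moreover have "0 \<le> C n * (\<bar>g t\<bar> * logistic_kernel 1 (t - x))"
          using logistic_kernel_nonneg[of 1 "t - x"] by (simp add: C_def)
        ultimately show ?thesis by linarith
      next
        case False
        define u where "u = t - x"
        have "logistic_kernel (real (Suc n)) u \<le> real (Suc n) * exp (- \<bar>real (Suc n) * u\<bar>)"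
          unfolding logistic_kernel_def by (intro mult_left_mono logistic_density_bounds) auto
        also have "\<dots> = real (Suc n) * (exp (- (real n * \<bar>u\<bar>)) * exp (- \<bar>u\<bar>))"
        proof -
          have "\<bar>real (Suc n) * u\<bar> = real n * \<bar>u\<bar> + \<bar>u\<bar>"
            by (subst abs_mult) (simp add: algebra_simps)
          then show ?thesis by (simp add: exp_add[symmetric])
        qed
        also have "\<dots> \<le> real (Suc n) * (exp (- (real n * \<delta>)) * exp (- \<bar>u\<bar>))"
          using False by (intro mult_left_mono mult_right_mono) (auto simp: u_def intro!: mult_left_mono)
        also have "\<dots> = C n * (exp (- \<bar>u\<bar>) / 4)" by (simp add: C_def)
        also have "\<dots> \<le> C n * logistic_kernel 1 u"
          using logistic_density_bounds(1)[of u]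
          by (intro mult_left_mono) (simp_all add: logistic_kernel_def C_def)
        finally have "\<bar>g t\<bar> * logistic_kernel (real (Suc n)) u \<le> \<bar>g t\<bar> * (C n * logistic_kernel 1 u)"
          by (intro mult_left_mono) auto
        moreover have "0 \<le> logistic_kernel (real (Suc n)) u" by (rule logistic_kernel_nonneg) simp
        moreover have "0 \<le> (e / 2) * logistic_kernel (real (Suc n)) u"
          using e by (intro mult_nonneg_nonneg logistic_kernel_nonneg) auto
        ultimately show ?thesis by (simp add: u_def abs_mult mult_ac)
      qed
      have i1: "integrable lborel (\<lambda>t. \<bar>g t\<bar> * logistic_kernel 1 (t - x))"
        using integrable_abs[OF intg[of 1]] logistic_kernel_nonneg[of 1] by (simp add: abs_mult)
      have "\<bar>integral\<^sup>L lborel (\<lambda>t. g t * logistic_kernel (real (Suc n)) (t - x))\<bar>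
          \<le> integral\<^sup>L lborel (\<lambda>t. (e / 2) * logistic_kernel (real (Suc n)) (t - x)
              + C n * (\<bar>g t\<bar> * logistic_kernel 1 (t - x)))"
        using pt i1 K[of "real (Suc n)"] intg[of "real (Suc n)"]
        by (intro order_trans[OF integral_abs_bound] integral_mono integrable_abs) auto
      also have "\<dots> = e / 2 + C n * I"
        using i1 K[of "real (Suc n)"] by (simp add: I_def)
      finally show ?thesis .
    qed
    have "C \<longlonglongrightarrow> 0" unfolding C_def using \<delta>(1) by real_asymp
    then have "(\<lambda>n. e / 2 + C n * I) \<longlonglongrightarrow> e / 2 + 0 * I"
      by (intro tendsto_intros)
    then have "\<forall>\<^sub>F n in sequentially. e / 2 + C n * I < e"
      using e by (intro order_tendstoD(2)[of _ "e / 2 + 0 * I"]) auto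
    then obtain N where "\<And>n. n \<ge> N \<Longrightarrow> e / 2 + C n * I < e"
      by (auto simp: eventually_sequentially)
    then show "\<exists>N. \<forall>n\<ge>N. norm (integral\<^sup>L lborel (\<lambda>t. g t * logistic_kernel (real (Suc n)) (t - x)) - 0) < e"
      using bound by (intro exI[of _ N] allI impI) (force intro: le_less_trans)
  qed
  show ?thesis
    by (rule LIM_zero_cancel) (use lim in \<open>simp add: shift\<close>)
qed

section \<open>Divided differences as integrals against hat functions\<close>

definition ramp :: "real \<Rightarrow> real \<Rightarrow> real \<Rightarrow> real" where
  "ramp p q t = (max 0 (t - p) - max 0 (t - q)) / (q - p)"

text \<open>
  Written as differences of ramps, the hats over consecutive nodes telescope.
\<close>

definition hat :: "real \<Rightarrow> real \<Rightarrow> real \<Rightarrow> real \<Rightarrow> real" where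
  "hat p q r t = ramp p q t - ramp q r t"

definition slope :: "(real \<Rightarrow> real) \<Rightarrow> real \<Rightarrow> real \<Rightarrow> real" where
  "slope f p q = (f q - f p) / (q - p)"

lemma ramp_eq_0: "p < q \<Longrightarrow> t \<le> p \<Longrightarrow> ramp p q t = 0"
  and ramp_eq_1: "p < q \<Longrightarrow> q \<le> t \<Longrightarrow> ramp p q t = 1"
  and ramp_nonneg: "p < q \<Longrightarrow> 0 \<le> ramp p q t"
  and ramp_le_1: "p < q \<Longrightarrow> ramp p q t \<le> 1"
  by (auto simp: ramp_def max_def field_simps)

lemma hat_nonneg: "p < q \<Longrightarrow> q < r \<Longrightarrow> 0 \<le> hat p q r t"
  using ramp_eq_1[of p q t] ramp_le_1[of q r t] ramp_eq_0[of q r t] ramp_nonneg[of p q t]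
  by (cases "q \<le> t") (auto simp: hat_def)

lemma hat_pos_iff: "p < q \<Longrightarrow> q < r \<Longrightarrow> 0 < hat p q r t \<longleftrightarrow> p < t \<and> t < r"
  by (cases "t \<le> q") (auto simp: hat_def ramp_def max_def zero_less_divide_iff divide_less_eq_1)

lemma abs_hat_le_1:
  assumes "p < q" "q < r"
  shows "\<bar>hat p q r t\<bar> \<le> 1"
  using ramp_nonneg[OF assms(1), of t] ramp_le_1[OF assms(1), of t]
    ramp_nonneg[OF assms(2), of t] ramp_le_1[OF assms(2), of t]
  by (auto simp: hat_def abs_le_iff)

lemma borel_measurable_ramp [measurable]: "ramp p q \<in> borel_measurable borel"
  unfolding ramp_def[abs_def] by measurable

lemma borel_measurable_hat [measurable]: "hat p q r \<in> borel_measurable borel"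
  unfolding hat_def[abs_def] by measurable

text \<open>
  A smooth approximation of \<open>max 0 u\<close> whose derivative is the logistic function of \<open>\<kappa> u\<close>.
\<close>

definition softplus :: "real \<Rightarrow> real \<Rightarrow> real" where
  "softplus \<kappa> u = ln (1 + exp (\<kappa> * u)) / \<kappa>"

lemma DERIV_softplus:
  assumes "\<kappa> > 0"
  shows "((\<lambda>t. softplus \<kappa> (t - x)) has_real_derivative logistic (\<kappa> * (t - x))) (at t)"
proof -
  have pos: "1 + exp (\<kappa> * (t - x)) > 0" by (simp add: add_pos_pos)
  have "exp (\<kappa> * (t - x)) / (1 + exp (\<kappa> * (t - x))) = logistic (\<kappa> * (t - x))"
  proof -
    have "1 + exp (\<kappa> * (t - x)) = exp (\<kappa> * (t - x)) * (1 + exp (- (\<kappa> * (t - x))))"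
      by (simp add: distrib_left exp_add[symmetric])
    then show ?thesis by (simp add: logistic_def)
  qed
  moreover have "((\<lambda>t. ln (1 + exp (\<kappa> * (t - x))) / \<kappa>) has_real_derivative
      exp (\<kappa> * (t - x)) / (1 + exp (\<kappa> * (t - x)))) (at t)"
    using assms pos by (auto intro!: derivative_eq_intros)
  ultimately show ?thesis by (simp add: softplus_def)
qed

lemma softplus_minus:
  assumes "\<kappa> > 0"
  shows "softplus \<kappa> (- u) = softplus \<kappa> u - u"
proof -
  have pos: "1 + exp (\<kappa> * u) > 0" "1 + exp (- (\<kappa> * u)) > 0" by (simp_all add: add_pos_pos)
  have "1 + exp (\<kappa> * u) = exp (\<kappa> * u) * (1 + exp (- (\<kappa> * u)))"
    by (simp add: algebra_simps exp_minus)
  then have "ln (1 + exp (\<kappa> * u)) = \<kappa> * u + ln (1 + exp (- (\<kappa> * u)))"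
    using pos by (metis exp_not_eq_zero ln_exp ln_mult_pos exp_gt_zero)
  then show ?thesis using assms by (simp add: softplus_def field_simps)
qed

lemma softplus_nonneg: "\<kappa> > 0 \<Longrightarrow> 0 \<le> softplus \<kappa> u"
  by (simp add: softplus_def add_pos_pos)

lemma softplus_le_exp: "\<kappa> > 0 \<Longrightarrow> softplus \<kappa> u \<le> exp (\<kappa> * u) / \<kappa>"
  by (simp add: softplus_def divide_right_mono ln_add_one_self_le_self)

lemma softplus_mono: "\<kappa> > 0 \<Longrightarrow> u \<le> v \<Longrightarrow> softplus \<kappa> u \<le> softplus \<kappa> v"
  by (simp add: softplus_def divide_right_mono add_pos_pos)

lemma softplus_diff_le:
  assumes "\<kappa> > 0" "u \<le> v"
  shows "softplus \<kappa> v - softplus \<kappa> u \<le> v - u"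
  using softplus_mono[of \<kappa> "- v" "- u"] assms by (simp add: softplus_minus)

lemma softplus_bounds:
  assumes "\<kappa> > 0"
  shows "max 0 u \<le> softplus \<kappa> u" "softplus \<kappa> u \<le> max 0 u + 1 / \<kappa>"
proof -
  have *: "softplus \<kappa> v \<le> 1 / \<kappa>" if "v \<le> 0" for v
  proof -
    have "exp (\<kappa> * v) \<le> 1" using assms that by (simp add: mult_nonneg_nonpos)
    then show ?thesis
      using softplus_le_exp[OF assms, of v] divide_right_mono[of "exp (\<kappa> * v)" 1 \<kappa>] assms by simp
  qed
  show "max 0 u \<le> softplus \<kappa> u"
    using softplus_nonneg[OF assms, of u] softplus_nonneg[OF assms, of "- u"]
    by (simp add: softplus_minus[OF assms])
  show "softplus \<kappa> u \<le> max 0 u + 1 / \<kappa>"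
    using *[of u] *[of "- u"] by (cases "u \<le> 0") (auto simp: softplus_minus[OF assms])
qed

lemma softplus_tendsto: "(\<lambda>n. softplus (real (Suc n)) u) \<longlonglongrightarrow> max 0 u"
proof (rule real_tendsto_sandwich[where f = "\<lambda>_. max 0 u" and h = "\<lambda>n. max 0 u + 1 / real (Suc n)"])
  have "(\<lambda>n. max 0 u + 1 / real (Suc n)) \<longlonglongrightarrow> max 0 u + 0"
    by (intro tendsto_add tendsto_const LIMSEQ_Suc[OF lim_1_over_n])
  then show "(\<lambda>n. max 0 u + 1 / real (Suc n)) \<longlonglongrightarrow> max 0 u" by simp
qed (intro always_eventually allI softplus_bounds tendsto_const; simp)+

text \<open>
  A Schwartz approximation of the hat function, with softplus functions in place of hinges.
\<close>

definition smooth_hat :: "real \<Rightarrow> real \<Rightarrow> real \<Rightarrow> real \<Rightarrow> real \<Rightarrow> real" where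
  "smooth_hat \<kappa> p q r t = (softplus \<kappa> (t - p) - softplus \<kappa> (t - q)) / (q - p)
     - (softplus \<kappa> (t - q) - softplus \<kappa> (t - r)) / (r - q)"

text \<open>
  For \<open>s\<close> the softplus or the logistic function, the decay of \<open>s\<close> at \<open>-\<infinity>\<close> controls the
  combination for \<open>t \<le> 0\<close>. For \<open>t \<ge> 0\<close> the same bound applies to the reflected combination, which
  has the same modulus: \<open>s u\<close> and \<open>\<plusminus> s (- u)\<close> differ by an affine function, and the coefficients annihilate
  affine functions.
\<close>

lemma second_difference_decay:
  fixes s :: "real \<Rightarrow> real" and p q r \<kappa> K :: real
  defines "D \<equiv> \<lambda>s t. (s (t - p) - s (t - q)) / (q - p) - (s (t - q) - s (t - r)) / (r - q)"
  assumes \<kappa>: "\<kappa> > 0" and pqr: "p < q" "q < r"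
    and s: "\<And>u. \<bar>s u\<bar> \<le> K * exp (\<kappa> * u)"
    and refl: "\<And>t. \<bar>D s t\<bar> = \<bar>D (\<lambda>u. s (- u)) t\<bar>"
  shows "bounded (range (\<lambda>t. t ^ k * D s t))"
proof (rule bounded_power_times_exp_decay[OF \<kappa>])
  fix t
  define B where "B = K * exp (\<kappa> * (\<bar>p\<bar> + \<bar>q\<bar> + \<bar>r\<bar>))"
  have K: "0 \<le> K"
    using s[of 0] by simp
  have tri: "\<bar>(a - b) / (q - p) - (b - c) / (r - q)\<bar> \<le> (2 / (q - p) + 2 / (r - q)) * m"
    if "\<bar>a\<bar> \<le> m" "\<bar>b\<bar> \<le> m" "\<bar>c\<bar> \<le> m" for a b c m :: real
  proof -
    have "\<bar>(a - b) / (q - p)\<bar> \<le> 2 * m / (q - p)" "\<bar>(b - c) / (r - q)\<bar> \<le> 2 * m / (r - q)"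
      unfolding abs_divide using that pqr by (auto intro!: frac_le)
    then have "\<bar>(a - b) / (q - p) - (b - c) / (r - q)\<bar> \<le> 2 * m / (q - p) + 2 * m / (r - q)"
      by (intro order_trans[OF abs_triangle_ineq4] add_mono)
    then show ?thesis by (simp add: distrib_right)
  qed
  have e: "\<bar>s (\<sigma> * (t - x))\<bar> \<le> B * exp (\<kappa> * (\<sigma> * t))"
    if "\<sigma> \<in> {1, -1}" "x \<in> {p, q, r}" for \<sigma> x
  proof -
    have "\<sigma> * (t - x) \<le> (\<bar>p\<bar> + \<bar>q\<bar> + \<bar>r\<bar>) + \<sigma> * t"
      using that by auto
    then have "exp (\<kappa> * (\<sigma> * (t - x))) \<le> exp (\<kappa> * ((\<bar>p\<bar> + \<bar>q\<bar> + \<bar>r\<bar>) + \<sigma> * t))"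
      using \<kappa> by simp
    then have "K * exp (\<kappa> * (\<sigma> * (t - x))) \<le> B * exp (\<kappa> * (\<sigma> * t))"
      using K mult_left_mono by (fastforce simp: B_def distrib_left exp_add)
    then show ?thesis using s[of "\<sigma> * (t - x)"] by linarith
  qed
  have pos: "\<bar>D s t\<bar> \<le> (2 / (q - p) + 2 / (r - q)) * (B * exp (\<kappa> * t))"
    unfolding D_def using e[of 1] by (intro tri) auto
  have "\<bar>D (\<lambda>u. s (- u)) t\<bar> \<le> (2 / (q - p) + 2 / (r - q)) * (B * exp (- (\<kappa> * t)))"
    unfolding D_def using e[of "- 1"] by (intro tri) auto
  with pos refl[of t] show "\<bar>D s t\<bar> \<le> (2 / (q - p) + 2 / (r - q)) * B * exp (- \<kappa> * \<bar>t\<bar>)"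
    by (cases "0 \<le> t") (simp_all add: mult.assoc)
qed

lemma
  assumes \<kappa>: "\<kappa> > 0" and pqr: "p < q" "q < r"
  shows schwartz_smooth_hat: "smooth_hat \<kappa> p q r \<in> schwartz"
    and deriv2_smooth_hat: "deriv (deriv (smooth_hat \<kappa> p q r)) =
      (\<lambda>t. (logistic_kernel \<kappa> (t - p) - logistic_kernel \<kappa> (t - q)) / (q - p)
         - (logistic_kernel \<kappa> (t - q) - logistic_kernel \<kappa> (t - r)) / (r - q))"
proof -
  \<comment> \<open>the first and second derivatives of the smooth hat, shown to be Schwartz functions in reverse order\<close>
  define \<psi>1 where "\<psi>1 = (\<lambda>t. (logistic (\<kappa> * (t - p)) - logistic (\<kappa> * (t - q))) / (q - p)
         - (logistic (\<kappa> * (t - q)) - logistic (\<kappa> * (t - r))) / (r - q))"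
  define \<psi>2 where "\<psi>2 = (\<lambda>t. (logistic_kernel \<kappa> (t - p) - logistic_kernel \<kappa> (t - q)) / (q - p)
         - (logistic_kernel \<kappa> (t - q) - logistic_kernel \<kappa> (t - r)) / (r - q))"
  have d1: "(smooth_hat \<kappa> p q r has_real_derivative \<psi>1 t) (at t)" for t
    unfolding smooth_hat_def[abs_def] \<psi>1_def by (intro DERIV_diff DERIV_cdivide DERIV_softplus \<kappa>)
  have d2: "(\<psi>1 has_real_derivative \<psi>2 t) (at t)" for t
    unfolding \<psi>1_def \<psi>2_def by (intro DERIV_diff DERIV_cdivide DERIV_logistic_scaled)
  have "\<psi>2 = (\<lambda>t. 1 / (q - p) * logistic_kernel \<kappa> (t - p)
      + ((- 1 / (q - p) - 1 / (r - q)) * logistic_kernel \<kappa> (t - q) + 1 / (r - q) * logistic_kernel \<kappa> (t - r)))"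
    using pqr by (intro ext) (simp add: \<psi>2_def diff_divide_distrib left_diff_distrib)
  then have \<psi>2: "\<psi>2 \<in> schwartz"
    by (simp only:) (intro schwartz_add schwartz_cmult schwartz_logistic_kernel \<kappa>)
  have "bounded (range (\<lambda>t. t ^ k * \<psi>1 t))" for k
    unfolding \<psi>1_def
  proof (rule second_difference_decay[where s = "\<lambda>u. logistic (\<kappa> * u)" and K = 1, OF \<kappa> pqr])
    show "\<bar>logistic (\<kappa> * u)\<bar> \<le> 1 * exp (\<kappa> * u)" for u
      using logistic_le_exp[of "\<kappa> * u"] logistic_pos[of "\<kappa> * u"] by simp
    have "logistic (\<kappa> * - (t - x)) = 1 - logistic (\<kappa> * (t - x))" for t x
      using logistic_minus[of "\<kappa> * (t - x)"] by (simp only: mult_minus_right)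
    note reflect = this
    show "\<bar>(logistic (\<kappa> * (t - p)) - logistic (\<kappa> * (t - q))) / (q - p) -
          (logistic (\<kappa> * (t - q)) - logistic (\<kappa> * (t - r))) / (r - q)\<bar> =
        \<bar>(logistic (\<kappa> * - (t - p)) - logistic (\<kappa> * - (t - q))) / (q - p) -
          (logistic (\<kappa> * - (t - q)) - logistic (\<kappa> * - (t - r))) / (r - q)\<bar>" for t
      unfolding reflect by (subst abs_minus_cancel[symmetric]) (simp add: diff_divide_distrib del: abs_minus_cancel)
  qed
  then have \<psi>1: "\<psi>1 \<in> schwartz"
    by (rule schwartz_antiderivative[OF \<psi>2 d2])
  have "bounded (range (\<lambda>t. t ^ k * smooth_hat \<kappa> p q r t))" for k
    unfolding smooth_hat_def
  proof (rule second_difference_decay[where s = "softplus \<kappa>" and K = "1 / \<kappa>", OF \<kappa> pqr])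
    show "\<bar>softplus \<kappa> u\<bar> \<le> 1 / \<kappa> * exp (\<kappa> * u)" for u
      using softplus_le_exp[OF \<kappa>, of u] softplus_nonneg[OF \<kappa>, of u] by simp
    have "(a - (t - x) - (b - (t - z))) / (z - x) = (a - b) / (z - x) - 1" if "x < z" for a b t x z :: real
      using that by (simp add: field_simps)
    note reflect = this[OF pqr(1)] this[OF pqr(2)]
    show "\<bar>(softplus \<kappa> (t - p) - softplus \<kappa> (t - q)) / (q - p)
          - (softplus \<kappa> (t - q) - softplus \<kappa> (t - r)) / (r - q)\<bar>
        = \<bar>(softplus \<kappa> (- (t - p)) - softplus \<kappa> (- (t - q))) / (q - p)
          - (softplus \<kappa> (- (t - q)) - softplus \<kappa> (- (t - r))) / (r - q)\<bar>" for t
      unfolding softplus_minus[OF \<kappa>] reflect by simp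
  qed
  then show "smooth_hat \<kappa> p q r \<in> schwartz"
    by (rule schwartz_antiderivative[OF \<psi>1 d1])
  have "deriv (smooth_hat \<kappa> p q r) = \<psi>1" "deriv \<psi>1 = \<psi>2"
    using d1 d2 by (auto intro!: DERIV_imp_deriv)
  then show "deriv (deriv (smooth_hat \<kappa> p q r)) = \<psi>2" by simp
qed

lemma abs_smooth_hat_le_1:
  assumes \<kappa>: "\<kappa> > 0" and pqr: "p < q" "q < r"
  shows "\<bar>smooth_hat \<kappa> p q r t\<bar> \<le> 1"
proof -
  have "0 \<le> (softplus \<kappa> (t - a) - softplus \<kappa> (t - b)) / (b - a)"
    "(softplus \<kappa> (t - a) - softplus \<kappa> (t - b)) / (b - a) \<le> 1" if "a < b" for a b
    using that softplus_mono[OF \<kappa>, of "t - b" "t - a"] softplus_diff_le[OF \<kappa>, of "t - b" "t - a"]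
    by (auto simp: field_simps)
  from this[OF pqr(1)] this[OF pqr(2)] show ?thesis
    by (simp add: smooth_hat_def abs_le_iff)
qed

lemma smooth_hat_tendsto:
  "(\<lambda>n. smooth_hat (real (Suc n)) p q r t) \<longlonglongrightarrow> hat p q r t"
  unfolding smooth_hat_def hat_def ramp_def divide_inverse by (intro tendsto_intros softplus_tendsto)

text \<open>
  Peano kernel formula: the hat function is the Peano kernel of the second divided difference.
  Testing \<open>D\<^sup>2 f = \<nu>\<close> against the smooth hat gives \<open>\<integral> f k = \<integral> h d\<nu>\<close> where \<open>h\<close> is the smooth hat and \<open>k\<close> a
  combination of logistic kernels approximating point masses at \<open>p\<close>, \<open>q\<close>, \<open>r\<close>. Let the kernels sharpen.
\<close>

lemma divided_difference_eq_signed_integral: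
  assumes cont: "continuous_on UNIV f"
    and int: "\<And>\<phi>. \<phi> \<in> schwartz \<Longrightarrow> integrable lborel (\<lambda>t. f t * \<phi> t)"
    and D2: "has_D2 f \<nu>" and pqr: "p < q" "q < r"
  shows "signed_integral \<nu> (hat p q r) = slope f q r - slope f p q"
proof -
  define J where "J = (\<lambda>n x. integral\<^sup>L lborel (\<lambda>t. f t * logistic_kernel (real (Suc n)) (t - x)))"
  have kint: "integrable lborel (\<lambda>t. f t * logistic_kernel \<kappa> (t - x))" if "\<kappa> > 0" for \<kappa> x
    by (intro int schwartz_logistic_kernel that)
  have J: "(\<lambda>n. J n x) \<longlonglongrightarrow> f x" for x
    unfolding J_def using cont
    by (intro logistic_kernel_approximate_identity kint) (auto simp: continuous_on_eq_continuous_at)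
  have eq: "signed_integral \<nu> (smooth_hat (real (Suc n)) p q r)
      = (J n p - J n q) / (q - p) - (J n q - J n r) / (r - q)" for n
  proof -
    let ?\<kappa> = "real (Suc n)"
    have "signed_integral \<nu> (smooth_hat ?\<kappa> p q r)
        = distr_deriv (distr_deriv (distr_of_fun f)) (smooth_hat ?\<kappa> p q r)"
      using D2 schwartz_smooth_hat[of ?\<kappa> p q r] pqr by (simp add: has_D2_def)
    also have "\<dots> = integral\<^sup>L lborel (\<lambda>t. f t * deriv (deriv (smooth_hat ?\<kappa> p q r)) t)"
      by (simp add: distr_deriv_def distr_of_fun_def)
    also have "\<dots> = integral\<^sup>L lborel (\<lambda>t.
        (f t * logistic_kernel ?\<kappa> (t - p) - f t * logistic_kernel ?\<kappa> (t - q)) / (q - p)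
      - (f t * logistic_kernel ?\<kappa> (t - q) - f t * logistic_kernel ?\<kappa> (t - r)) / (r - q))"
      using deriv2_smooth_hat[of ?\<kappa> p q r] pqr by (simp add: right_diff_distrib)
    also have "\<dots> = (J n p - J n q) / (q - p) - (J n q - J n r) / (r - q)"
      unfolding J_def using kint[of ?\<kappa>] by (simp del: of_nat_Suc)
    finally show ?thesis .
  qed
  have \<nu>: "finite_signed_measure \<nu>" using D2 by (simp add: has_D2_def)
  have "(\<lambda>n. signed_integral \<nu> (smooth_hat (real (Suc n)) p q r)) \<longlonglongrightarrow> signed_integral \<nu> (hat p q r)"
  proof (rule signed_integral_tendsto[OF \<nu>, where B = 1])
    show "smooth_hat (real (Suc n)) p q r \<in> borel_measurable borel" for n
      using schwartz_smooth_hat[of "real (Suc n)" p q r] pqr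
      by (intro borel_measurable_continuous_onI continuous_on_schwartz) simp
    show "\<bar>smooth_hat (real (Suc n)) p q r t\<bar> \<le> 1" for n t
      using pqr by (intro abs_smooth_hat_le_1) simp_all
  qed (use smooth_hat_tendsto in auto)
  moreover have "(\<lambda>n. signed_integral \<nu> (smooth_hat (real (Suc n)) p q r)) \<longlonglongrightarrow>
      (f p - f q) / (q - p) - (f q - f r) / (r - q)"
    unfolding eq divide_inverse by (intro tendsto_intros J)
  ultimately have "signed_integral \<nu> (hat p q r) = (f p - f q) / (q - p) - (f q - f r) / (r - q)"
    by (rule LIMSEQ_unique)
  then show ?thesis by (simp add: slope_def diff_divide_distrib)
qed

text \<open>
  By the Peano formula \<open>f\<close> determines the integrals of hat functions. Sums of two of them are
  trapezoids, which converge to indicators of half-open intervals, and these intervals generate the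
  Borel sets.
\<close>

lemma has_D2_unique:
  assumes cont: "continuous_on UNIV f"
    and int: "\<And>\<phi>. \<phi> \<in> schwartz \<Longrightarrow> integrable lborel (\<lambda>t. f t * \<phi> t)"
    and \<nu>: "has_D2 f \<nu>" and \<mu>: "has_D2 f \<mu>"
  shows "\<nu> = \<mu>"
proof -
  have fsm: "finite_signed_measure \<nu>" "finite_signed_measure \<mu>"
    using \<nu> \<mu> by (simp_all add: has_D2_def)
  define trapezoid where
    "trapezoid = (\<lambda>a b n t. hat a (a + (b - a) / (n + 2)) b t
        + hat (a + (b - a) / (n + 2)) b (b + (b - a) / (n + 2)) t :: real)"
  have step: "(\<lambda>n. ramp c (c + d / (real n + 2)) t) \<longlonglongrightarrow> (if c < t then 1 else 0)" if "d > 0" for c d t :: real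
  proof (cases "c < t")
    case True
    have "(\<lambda>n. c + d / (real n + 2)) \<longlonglongrightarrow> c" by real_asymp
    then have "\<forall>\<^sub>F n in sequentially. c + d / (real n + 2) < t"
      using True by (rule order_tendstoD)
    then have "\<forall>\<^sub>F n in sequentially. ramp c (c + d / (real n + 2)) t = 1"
      by eventually_elim (use that in \<open>auto intro!: ramp_eq_1\<close>)
    with True show ?thesis by (simp add: tendsto_eventually)
  next
    case False
    have "ramp c (c + d / (real n + 2)) t = 0" for n
      using that False by (intro ramp_eq_0) auto
    with False show ?thesis by simp
  qed
  have lim: "(\<lambda>n. signed_integral \<rho> (trapezoid a b (real n))) \<longlonglongrightarrow> \<rho> {a<..b}"
    if ab: "a < b" and \<rho>: "finite_signed_measure \<rho>" for a b \<rho>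
  proof -
    have tr: "trapezoid a b (real n) t
        = ramp a (a + (b - a) / (real n + 2)) t - ramp b (b + (b - a) / (real n + 2)) t" for n t
      by (simp add: trapezoid_def hat_def)
    have "(\<lambda>n. signed_integral \<rho> (trapezoid a b (real n))) \<longlonglongrightarrow> signed_integral \<rho> (indicator {a<..b})"
    proof (rule signed_integral_tendsto[OF \<rho>, where B = 1])
      show "trapezoid a b (real n) \<in> borel_measurable borel" for n
        unfolding trapezoid_def by measurable
      show "\<bar>trapezoid a b (real n) t\<bar> \<le> 1" for n t
        unfolding tr using ab ramp_nonneg[of a "a + (b - a) / (real n + 2)" t]
          ramp_le_1[of a "a + (b - a) / (real n + 2)" t] ramp_nonneg[of b "b + (b - a) / (real n + 2)" t]
          ramp_le_1[of b "b + (b - a) / (real n + 2)" t] by (auto simp: abs_le_iff)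
      have "(\<lambda>n. trapezoid a b (real n) t) \<longlonglongrightarrow> (if a < t then 1 else 0) - (if b < t then 1 else 0)" for t
        unfolding tr using ab by (intro tendsto_diff step) auto
      moreover have "(if a < t then 1 else 0) - (if b < t then 1 else 0) = (indicator {a<..b} t :: real)" for t
        using ab by (auto simp: indicator_def)
      ultimately show "(\<lambda>n. trapezoid a b (real n) t) \<longlonglongrightarrow> indicator {a<..b} t" for t by metis
    qed simp
    then show ?thesis by (simp add: signed_integral_indicator[OF \<rho>])
  qed
  have same: "signed_integral \<nu> (trapezoid a b (real n)) = signed_integral \<mu> (trapezoid a b (real n))"
    if ab: "a < b" for a b n
  proof -
    define h where "h = (b - a) / (real n + 2)"
    have "(b - a) / (real n + 2) < (b - a) / 1"
      using ab by (intro divide_strict_left_mono) auto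
    then have h: "0 < h" "a + h < b" using ab by (auto simp: h_def)
    have "signed_integral \<rho> (trapezoid a b (real n))
        = signed_integral \<rho> (hat a (a + h) b) + signed_integral \<rho> (hat (a + h) b (b + h))"
      if "finite_signed_measure \<rho>" for \<rho>
      unfolding trapezoid_def h_def[symmetric] using h
      by (intro signed_integral_add[OF that, where B = 1 and C = 1] abs_hat_le_1) auto
    then show ?thesis
      using fsm h divided_difference_eq_signed_integral[OF cont int \<nu>]
        divided_difference_eq_signed_integral[OF cont int \<mu>] by simp
  qed
  have Ioc: "\<nu> {a<..b} = \<mu> {a<..b}" for a b
  proof (cases "a < b")
    case True
    show ?thesis
      using LIMSEQ_unique[OF lim[OF True fsm(1)]] lim[OF True fsm(2)] same[OF True] by simp
  next
    case False
    then show ?thesis using fsm by (simp add: finite_signed_measure_def)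
  qed
  have univ: "\<nu> UNIV = \<mu> UNIV"
  proof -
    have "(\<lambda>n. \<rho> {- real n<..real n}) \<longlonglongrightarrow> \<rho> UNIV" if \<rho>: "finite_signed_measure \<rho>" for \<rho>
    proof -
      have "(\<lambda>n. signed_integral \<rho> (indicator {- real n<..real n})) \<longlonglongrightarrow> signed_integral \<rho> (indicator UNIV)"
      proof (rule signed_integral_tendsto[OF \<rho>, where B = 1])
        fix t :: real
        obtain N where "\<bar>t\<bar> < real N" using reals_Archimedean2 by blast
        then have "\<forall>\<^sub>F n in sequentially. indicator {- real n<..real n} t = (indicator UNIV t :: real)"
          by (intro eventually_sequentiallyI[of N]) (auto simp: indicator_def)
        then show "(\<lambda>n. indicator {- real n<..real n} t) \<longlonglongrightarrow> (indicator UNIV t :: real)"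
          by (rule tendsto_eventually)
      qed (auto simp: indicator_def)
      then show ?thesis by (simp add: signed_integral_indicator[OF \<rho>] del: indicator_UNIV)
    qed
    from LIMSEQ_unique[OF this[OF fsm(1)]] this[OF fsm(2)] show ?thesis by (simp add: Ioc)
  qed
  let ?G = "range (\<lambda>(a, b). {a<..b::real})"
  have borel: "sets borel = sigma_sets UNIV ?G"
    by (subst borel_sigma_sets_Ioc) (simp add: sets_measure_of)
  have G: "Int_stable ?G"
  proof (rule Int_stableI)
    fix A B assume "A \<in> ?G" "B \<in> ?G"
    then obtain a b c d where "A = {a<..b}" "B = {c<..d}" by auto
    then have "A \<inter> B = (\<lambda>(a, b). {a<..b}) (max a c, min b d)" by auto
    then show "A \<inter> B \<in> ?G" by (rule range_eqI)
  qed
  have "?G \<subseteq> Pow UNIV" by simp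
  \<comment> \<open>the sets on which the two measures agree form a Dynkin system\<close>
  have "\<nu> A = \<mu> A" if "A \<in> sets borel" for A
    using G \<open>?G \<subseteq> Pow UNIV\<close> that[unfolded borel]
  proof (induction rule: sigma_sets_induct_disjoint)
    case (compl A)
    then have "A \<in> sets borel" by (simp only: borel)
    then show ?case
      using finite_signed_measure_Diff[OF fsm(1), of UNIV A] finite_signed_measure_Diff[OF fsm(2), of UNIV A] univ compl by simp
  next
    case (union A)
    then have "(\<lambda>n. \<nu> (A n)) sums \<nu> (\<Union>n. A n)" "(\<lambda>n. \<mu> (A n)) sums \<mu> (\<Union>n. A n)"
      using fsm unfolding finite_signed_measure_def borel by blast+
    then show ?case using union(3) sums_unique2 by simp
  qed (use fsm Ioc in \<open>auto simp: finite_signed_measure_def\<close>)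
  moreover have "\<nu> A = \<mu> A" if "A \<notin> sets borel" for A
    using that fsm by (simp add: finite_signed_measure_def)
  ultimately show ?thesis by blast
qed

lemma D2_eq:
  assumes "continuous_on UNIV f"
    and "\<And>\<phi>. \<phi> \<in> schwartz \<Longrightarrow> integrable lborel (\<lambda>t. f t * \<phi> t)"
    and "has_D2 f \<nu>"
  shows "D2 f = \<nu>"
  unfolding D2_def using assms(3) has_D2_unique[OF assms(1,2)] by blast

lemma BV2_has_D2:
  assumes "f \<in> BV2"
  shows "has_D2 f (D2 f)"
  using assms D2_eq unfolding BV2_def by blast

lemma BV2_divided_difference:
  assumes "f \<in> BV2" "p < q" "q < r"
  shows "signed_integral (D2 f) (hat p q r) = slope f q r - slope f p q"
  using assms BV2_has_D2[OF assms(1)]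
  by (intro divided_difference_eq_signed_integral) (auto simp: BV2_def)

section \<open>Piecewise-linear splines\<close>

lemma schwartz_seminorm_upper:
  assumes "\<phi> \<in> schwartz"
  shows "\<bar>t ^ k * (deriv ^^ n) \<phi> t\<bar> \<le> schwartz_seminorm k n \<phi>"
proof -
  have "bounded (range (\<lambda>t. t ^ k * (deriv ^^ n) \<phi> t))"
    using assms by (auto simp: schwartz_def)
  then obtain B where "\<And>t. \<bar>t ^ k * (deriv ^^ n) \<phi> t\<bar> \<le> B"
    unfolding bounded_iff by auto
  then have "bdd_above (range (\<lambda>t. \<bar>t ^ k * (deriv ^^ n) \<phi> t\<bar>))"
    by (auto intro!: bdd_aboveI)
  then show ?thesis
    unfolding schwartz_seminorm_def by (intro cSUP_upper) auto
qed

lemma schwartz_seminorm_nonneg: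
  "\<phi> \<in> schwartz \<Longrightarrow> 0 \<le> schwartz_seminorm k n \<phi>"
  using schwartz_seminorm_upper[of \<phi> 0 k n] by (rule order_trans[OF abs_ge_zero])

lemma schwartz_tendsto_0:
  assumes "\<phi> \<in> schwartz"
  shows "((\<lambda>t. t ^ k * \<phi> t) \<longlongrightarrow> 0) at_infinity"
proof (rule Lim_null_comparison)
  let ?B = "schwartz_seminorm (Suc k) 0 \<phi>"
  show "\<forall>\<^sub>F t in at_infinity. norm (t ^ k * \<phi> t) \<le> ?B * norm (inverse t)"
  proof (rule eventually_at_infinityI[of 1])
    fix t :: real assume "1 \<le> norm t"
    then have "0 < \<bar>t\<bar>" by simp
    then show "norm (t ^ k * \<phi> t) \<le> ?B * norm (inverse t)"
      using schwartz_seminorm_upper[OF assms, of t "Suc k" 0] by (simp add: abs_mult field_simps)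
  qed
  have "((\<lambda>t. ?B * norm (inverse t)) \<longlongrightarrow> ?B * norm (0 :: real)) (at_infinity :: real filter)"
    by (intro tendsto_intros tendsto_inverse_0)
  then show "((\<lambda>t. ?B * norm (inverse t)) \<longlongrightarrow> 0) (at_infinity :: real filter)" by simp
qed

lemma integrable_inverse_1_plus_square: "integrable lborel (\<lambda>t :: real. 1 / (1 + t\<^sup>2))"
proof -
  have "set_integrable lborel (einterval (-\<infinity>) \<infinity>) (\<lambda>t :: real. 1 / (1 + t\<^sup>2))"
  proof (rule interval_integral_FTC_nonneg(1)[where F = arctan and A = "- (pi / 2)" and B = "pi / 2"])
    show "((arctan \<circ> real_of_ereal) \<longlongrightarrow> - (pi / 2)) (at_right (- \<infinity>))"
      unfolding at_right_MInf comp_def filterlim_filtermap using tendsto_arctan_at_bot by simp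
    show "((arctan \<circ> real_of_ereal) \<longlongrightarrow> pi / 2) (at_left \<infinity>)"
      unfolding at_left_PInf comp_def filterlim_filtermap using tendsto_arctan_at_top by simp
    show "isCont (\<lambda>t :: real. 1 / (1 + t\<^sup>2)) t" for t
      by (intro continuous_intros) (simp add: add_nonneg_eq_0_iff)
    show "DERIV arctan t :> 1 / (1 + t\<^sup>2)" for t
      using DERIV_arctan[of t] by (simp add: inverse_eq_divide)
  qed auto
  then show ?thesis by (simp add: set_integrable_def einterval_def)
qed

lemma linear_growth_times_schwartz:
  assumes f: "continuous_on UNIV f" "\<And>t. \<bar>f t\<bar> \<le> C * (1 + \<bar>t\<bar>)" and \<phi>: "\<phi> \<in> schwartz"
  shows "integrable lborel (\<lambda>t. f t * \<phi> t)"
    and "\<bar>integral\<^sup>L lborel (\<lambda>t. f t * \<phi> t)\<bar>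
      \<le> 3 * C * integral\<^sup>L lborel (\<lambda>t. 1 / (1 + t\<^sup>2)) * (\<Sum>k\<le>4. \<Sum>n\<le>4. schwartz_seminorm k n \<phi>)"
proof -
  let ?S = "\<Sum>k\<le>4. \<Sum>n\<le>4. schwartz_seminorm k n \<phi>"
  have C: "0 \<le> C" using f(2)[of 0] by simp
  have seminorm_le: "schwartz_seminorm k 0 \<phi> \<le> (\<Sum>n\<le>4. schwartz_seminorm k n \<phi>)" for k
    using schwartz_seminorm_nonneg[OF \<phi>] by (intro member_le_sum) auto
  have pt: "\<bar>f t * \<phi> t\<bar> \<le> 3 * C * ?S * (1 / (1 + t\<^sup>2))" for t
  proof -
    have pos: "0 < 1 + t\<^sup>2" by (simp add: add_pos_nonneg)
    \<comment> \<open>the decay needed is one factor \<open>1 + t\<^sup>2\<close> beyond the growth of \<open>f\<close>, hence seminorms with \<open>t\<close> to the power at most 4\<close>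
    have "\<bar>t\<bar> \<le> 1 + t\<^sup>2"
      using sum_squares_bound[of "\<bar>t\<bar>" 1] by (simp add: power2_eq_square)
    then have "(1 + \<bar>t\<bar>) * (1 + t\<^sup>2) \<le> (2 + t\<^sup>2) * (1 + t\<^sup>2)"
      using pos by (intro mult_right_mono) auto
    then have "(1 + \<bar>t\<bar>) * (1 + t\<^sup>2) * \<bar>\<phi> t\<bar> \<le> (2 + t\<^sup>2) * (1 + t\<^sup>2) * \<bar>\<phi> t\<bar>"
      by (rule mult_right_mono) simp
    also have "\<dots> = 2 * \<bar>\<phi> t\<bar> + 3 * \<bar>t ^ 2 * \<phi> t\<bar> + \<bar>t ^ 4 * \<phi> t\<bar>"
      by (simp add: abs_mult algebra_simps flip: power_add)
    also have "\<dots> \<le> 2 * schwartz_seminorm 0 0 \<phi> + 3 * schwartz_seminorm 2 0 \<phi> + schwartz_seminorm 4 0 \<phi>"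
      using schwartz_seminorm_upper[OF \<phi>, of t _ 0] schwartz_seminorm_upper[OF \<phi>, of t 0 0]
      by (intro add_mono mult_left_mono) auto
    also have "\<dots> \<le> 3 * ?S"
    proof -
      let ?G = "\<lambda>k. \<Sum>n\<le>4. schwartz_seminorm k n \<phi>"
      have nonneg: "0 \<le> ?G k" for k
        using schwartz_seminorm_nonneg[OF \<phi>] by (intro sum_nonneg)
      have "sum ?G {0, 2, 4} \<le> ?S"
        using nonneg by (intro sum_mono2) auto
      then have "?G 0 + ?G 2 + ?G 4 \<le> ?S" by simp
      then show ?thesis
        using seminorm_le[of 0] seminorm_le[of 2] seminorm_le[of 4] nonneg[of 0] nonneg[of 2] nonneg[of 4]
        by linarith
    qed
    finally have "(1 + \<bar>t\<bar>) * \<bar>\<phi> t\<bar> \<le> 3 * ?S * (1 / (1 + t\<^sup>2))"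
      using pos by (simp add: field_simps)
    then have "C * ((1 + \<bar>t\<bar>) * \<bar>\<phi> t\<bar>) \<le> C * (3 * ?S * (1 / (1 + t\<^sup>2)))"
      using C by (rule mult_left_mono)
    moreover have "\<bar>f t * \<phi> t\<bar> \<le> C * (1 + \<bar>t\<bar>) * \<bar>\<phi> t\<bar>"
      unfolding abs_mult using f(2)[of t] by (rule mult_right_mono) simp
    ultimately show ?thesis by (simp add: mult_ac)
  qed
  have meas: "(\<lambda>t. f t * \<phi> t) \<in> borel_measurable lborel"
    using continuous_on_mult[OF f(1) continuous_on_schwartz[OF \<phi>]]
    by (simp add: borel_measurable_continuous_onI)
  have dom: "integrable lborel (\<lambda>t. 3 * C * ?S * (1 / (1 + t\<^sup>2)))"
    by (intro integrable_mult_right integrable_inverse_1_plus_square)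
  have "norm (f t * \<phi> t) \<le> norm (3 * C * ?S * (1 / (1 + t\<^sup>2)))" for t
    unfolding real_norm_def by (rule order_trans[OF pt abs_ge_self])
  then show int: "integrable lborel (\<lambda>t. f t * \<phi> t)"
    by (intro Bochner_Integration.integrable_bound[OF dom meas] AE_I2)
  have "\<bar>integral\<^sup>L lborel (\<lambda>t. f t * \<phi> t)\<bar> \<le> integral\<^sup>L lborel (\<lambda>t. 3 * C * ?S * (1 / (1 + t\<^sup>2)))"
    using pt int by (intro order_trans[OF integral_abs_bound] integral_mono dom) auto
  also have "\<dots> = 3 * C * integral\<^sup>L lborel (\<lambda>t. 1 / (1 + t\<^sup>2)) * ?S"
    by (subst integral_mult_right_zero) (simp add: mult_ac)
  finally show "\<bar>integral\<^sup>L lborel (\<lambda>t. f t * \<phi> t)\<bar> \<le> 3 * C * integral\<^sup>L lborel (\<lambda>t. 1 / (1 + t\<^sup>2)) * ?S" .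
qed

lemma DERIV_integration_by_parts:
  assumes "\<phi> \<in> schwartz"
  shows "((\<lambda>t. (c * t + d) * deriv \<phi> t - c * \<phi> t) has_real_derivative (c * t + d) * deriv (deriv \<phi>) t) (at t)"
proof -
  note [derivative_intros] = schwartz_DERIV[OF assms, of 0, simplified]
    schwartz_DERIV[OF assms, of 1, simplified]
  show ?thesis by (auto intro!: derivative_eq_intros simp: algebra_simps)
qed

lemma tendsto_integration_by_parts:
  assumes "\<phi> \<in> schwartz"
  shows "((\<lambda>t. (c * t + d) * deriv \<phi> t - c * \<phi> t) \<longlongrightarrow> 0) at_infinity"
proof -
  have "((\<lambda>t. c * (t ^ 1 * deriv \<phi> t) + d * (t ^ 0 * deriv \<phi> t) - c * (t ^ 0 * \<phi> t))
      \<longlongrightarrow> c * 0 + d * 0 - c * 0) at_infinity"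
    by (intro tendsto_intros schwartz_tendsto_0 assms schwartz_deriv)
  then show ?thesis by (simp add: algebra_simps)
qed

lemma isCont_linear_times_deriv2:
  assumes "\<phi> \<in> schwartz"
  shows "isCont (\<lambda>t. (c * t + d) * deriv (deriv \<phi>) t) t"
  using continuous_on_schwartz[OF schwartz_deriv[OF schwartz_deriv[OF assms]], of UNIV]
  by (auto simp: continuous_on_eq_continuous_at intro!: continuous_intros)

lemma integral_affine_times_deriv2:
  assumes \<phi>: "\<phi> \<in> schwartz"
  shows "integrable lborel (\<lambda>t. (c * t + d) * deriv (deriv \<phi>) t)"
    and "integral\<^sup>L lborel (\<lambda>t. (c * t + d) * deriv (deriv \<phi>) t) = 0"
proof -
  have growth: "\<bar>c * t + d\<bar> \<le> (\<bar>c\<bar> + \<bar>d\<bar>) * (1 + \<bar>t\<bar>)" for t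
  proof -
    have "\<bar>c * t + d\<bar> \<le> \<bar>c\<bar> * \<bar>t\<bar> + \<bar>d\<bar>" using abs_triangle_ineq[of "c * t" d] by (simp add: abs_mult)
    also have "\<dots> \<le> (\<bar>c\<bar> + \<bar>d\<bar>) * (1 + \<bar>t\<bar>)" by (simp add: algebra_simps)
    finally show ?thesis .
  qed
  show int: "integrable lborel (\<lambda>t. (c * t + d) * deriv (deriv \<phi>) t)"
    by (rule linear_growth_times_schwartz(1)[OF _ growth]) (intro continuous_intros schwartz_deriv \<phi>)+
  let ?F = "\<lambda>t. (c * t + d) * deriv \<phi> t - c * \<phi> t"
  have "(LBINT t=-\<infinity>..\<infinity>. (c * t + d) * deriv (deriv \<phi>) t) = 0 - 0"
  proof (rule interval_integral_FTC_integrable)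
    show "((?F \<circ> real_of_ereal) \<longlongrightarrow> 0) (at_right (- \<infinity>))"
      unfolding at_right_MInf comp_def filterlim_filtermap
      using tendsto_mono[OF at_bot_le_at_infinity tendsto_integration_by_parts[OF \<phi>]] by simp
    show "((?F \<circ> real_of_ereal) \<longlongrightarrow> 0) (at_left \<infinity>)"
      unfolding at_left_PInf comp_def filterlim_filtermap
      using tendsto_mono[OF at_top_le_at_infinity tendsto_integration_by_parts[OF \<phi>]] by simp
    show "set_integrable lborel (einterval (- \<infinity>) \<infinity>) (\<lambda>t. (c * t + d) * deriv (deriv \<phi>) t)"
      using int by (simp add: set_integrable_def einterval_def)
    show "(?F has_vector_derivative (c * t + d) * deriv (deriv \<phi>) t) (at t)" for t
      using DERIV_integration_by_parts[OF \<phi>] by (simp add: has_real_derivative_iff_has_vector_derivative)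
    show "isCont (\<lambda>t. (c * t + d) * deriv (deriv \<phi>) t) t" for t
      by (rule isCont_linear_times_deriv2[OF \<phi>])
  qed simp
  then show "integral\<^sup>L lborel (\<lambda>t. (c * t + d) * deriv (deriv \<phi>) t) = 0"
    by (simp add: interval_lebesgue_integral_def set_lebesgue_integral_def einterval_def)
qed

text \<open>
  The hinge \<open>max 0 (t - \<tau>)\<close> is a fundamental solution of \<open>D\<^sup>2\<close>: on \<open>t > \<tau>\<close> the integrand has the primitive
  \<open>(t - \<tau>) \<phi>' - \<phi>\<close>, which vanishes at infinity.
\<close>

lemma integral_hinge_times_deriv2:
  assumes \<phi>: "\<phi> \<in> schwartz"
  shows "integrable lborel (\<lambda>t. max 0 (t - \<tau>) * deriv (deriv \<phi>) t)"
    and "integral\<^sup>L lborel (\<lambda>t. max 0 (t - \<tau>) * deriv (deriv \<phi>) t) = \<phi> \<tau>"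
proof -
  have growth: "\<bar>max 0 (t - \<tau>)\<bar> \<le> (1 + \<bar>\<tau>\<bar>) * (1 + \<bar>t\<bar>)" for t
  proof -
    have "\<bar>max 0 (t - \<tau>)\<bar> \<le> \<bar>t\<bar> + \<bar>\<tau>\<bar>" by (auto simp: max_def)
    also have "\<dots> \<le> (1 + \<bar>\<tau>\<bar>) * (1 + \<bar>t\<bar>)" by (simp add: algebra_simps)
    finally show ?thesis .
  qed
  show int: "integrable lborel (\<lambda>t. max 0 (t - \<tau>) * deriv (deriv \<phi>) t)"
    by (rule linear_growth_times_schwartz(1)[OF _ growth]) (intro continuous_intros schwartz_deriv \<phi>)+
  let ?F = "\<lambda>t. (1 * t + - \<tau>) * deriv \<phi> t - 1 * \<phi> t"
  have ind: "indicator (einterval \<tau> \<infinity>) t * ((1 * t + - \<tau>) * deriv (deriv \<phi>) t)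
      = max 0 (t - \<tau>) * deriv (deriv \<phi>) t" for t
    by (auto simp: indicator_def einterval_def max_def)
  have "(LBINT t=\<tau>..\<infinity>. (1 * t + - \<tau>) * deriv (deriv \<phi>) t) = 0 - (- \<phi> \<tau>)"
  proof (rule interval_integral_FTC_integrable[where F = ?F])
    have "(?F \<longlongrightarrow> ?F \<tau>) (at_right \<tau>)"
      using DERIV_isCont[OF DERIV_integration_by_parts[OF \<phi>, of 1 "- \<tau>" \<tau>]]
      unfolding isCont_def by (rule tendsto_mono[OF at_le[OF subset_UNIV]])
    then show "((?F \<circ> real_of_ereal) \<longlongrightarrow> - \<phi> \<tau>) (at_right (ereal \<tau>))"
      unfolding at_right_ereal comp_def filterlim_filtermap by simp
    show "((?F \<circ> real_of_ereal) \<longlongrightarrow> 0) (at_left \<infinity>)"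
      unfolding at_left_PInf comp_def filterlim_filtermap
      using tendsto_mono[OF at_top_le_at_infinity tendsto_integration_by_parts[OF \<phi>, of 1 "- \<tau>"]] by simp
    show "set_integrable lborel (einterval \<tau> \<infinity>) (\<lambda>t. (1 * t + - \<tau>) * deriv (deriv \<phi>) t)"
      using int by (simp only: set_integrable_def real_scaleR_def ind)
    show "(?F has_vector_derivative (1 * t + - \<tau>) * deriv (deriv \<phi>) t) (at t)" for t
      using DERIV_integration_by_parts[OF \<phi>, of 1 "- \<tau>"]
      by (simp add: has_real_derivative_iff_has_vector_derivative)
    show "isCont (\<lambda>t. (1 * t + - \<tau>) * deriv (deriv \<phi>) t) t" for t
      by (rule isCont_linear_times_deriv2[OF \<phi>])
  qed simp
  then show "integral\<^sup>L lborel (\<lambda>t. max 0 (t - \<tau>) * deriv (deriv \<phi>) t) = \<phi> \<tau>"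
    by (simp only: interval_lebesgue_integral_def set_lebesgue_integral_def real_scaleR_def ind) simp
qed

lemma tempered_distribution_linear_growth:
  assumes f: "continuous_on UNIV f" "\<And>t. \<bar>f t\<bar> \<le> C * (1 + \<bar>t\<bar>)"
  shows "tempered_distribution (distr_of_fun f)"
  unfolding tempered_distribution_def distr_of_fun_def
proof (intro conjI ballI allI exI)
  fix \<phi> \<psi> assume "\<phi> \<in> schwartz" "\<psi> \<in> schwartz"
  then show "integral\<^sup>L lborel (\<lambda>t. f t * (\<phi> t + \<psi> t))
      = integral\<^sup>L lborel (\<lambda>t. f t * \<phi> t) + integral\<^sup>L lborel (\<lambda>t. f t * \<psi> t)"
    using linear_growth_times_schwartz(1)[OF f] by (simp add: distrib_left)
next
  fix c \<phi>
  show "integral\<^sup>L lborel (\<lambda>t. f t * (c * \<phi> t)) = c * integral\<^sup>L lborel (\<lambda>t. f t * \<phi> t)"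
    by (simp add: mult.left_commute[of _ c])
next
  fix \<phi> assume "\<phi> \<in> schwartz"
  then show "\<bar>integral\<^sup>L lborel (\<lambda>t. f t * \<phi> t)\<bar>
      \<le> 3 * C * integral\<^sup>L lborel (\<lambda>t. 1 / (1 + t\<^sup>2)) * (\<Sum>k\<le>4. \<Sum>n\<le>4. schwartz_seminorm k n \<phi>)"
    by (rule linear_growth_times_schwartz(2)[OF f])
qed

lemma
  fixes c d :: real and a :: "real \<Rightarrow> real" and T :: "real set"
  assumes T: "finite T"
  defines "f \<equiv> \<lambda>t. c * t + d + (\<Sum>\<tau>\<in>T. a \<tau> * max 0 (t - \<tau>))"
  shows linear_spline_in_BV2: "f \<in> BV2"
    and D2_linear_spline: "D2 f = (\<lambda>A. \<Sum>\<tau>\<in>T. a \<tau> * dirac \<tau> A)"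
proof -
  have cont: "continuous_on UNIV f"
    unfolding f_def by (intro continuous_intros)
  define C where "C = \<bar>c\<bar> + \<bar>d\<bar> + (\<Sum>\<tau>\<in>T. \<bar>a \<tau>\<bar> * (1 + \<bar>\<tau>\<bar>))"
  have growth: "\<bar>f t\<bar> \<le> C * (1 + \<bar>t\<bar>)" for t
  proof -
    have "\<bar>a \<tau> * max 0 (t - \<tau>)\<bar> \<le> \<bar>a \<tau>\<bar> * (1 + \<bar>\<tau>\<bar>) * (1 + \<bar>t\<bar>)" for \<tau>
    proof -
      have "\<bar>max 0 (t - \<tau>)\<bar> \<le> \<bar>t\<bar> + \<bar>\<tau>\<bar>" by (auto simp: max_def)
      also have "\<dots> \<le> (1 + \<bar>\<tau>\<bar>) * (1 + \<bar>t\<bar>)" by (simp add: algebra_simps)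
      finally show ?thesis unfolding abs_mult mult.assoc by (intro mult_left_mono) auto
    qed
    then have "\<bar>\<Sum>\<tau>\<in>T. a \<tau> * max 0 (t - \<tau>)\<bar> \<le> (\<Sum>\<tau>\<in>T. \<bar>a \<tau>\<bar> * (1 + \<bar>\<tau>\<bar>)) * (1 + \<bar>t\<bar>)"
      unfolding sum_distrib_right by (intro order_trans[OF sum_abs] sum_mono)
    moreover have "\<bar>c * t + d\<bar> \<le> (\<bar>c\<bar> + \<bar>d\<bar>) * (1 + \<bar>t\<bar>)"
      by (rule order_trans[OF abs_triangle_ineq]) (simp add: abs_mult algebra_simps)
    ultimately show ?thesis
      unfolding f_def C_def distrib_right[of _ _ "1 + \<bar>t\<bar>"] by (auto intro: order_trans[OF abs_triangle_ineq add_mono])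
  qed
  have int: "integrable lborel (\<lambda>t. f t * \<phi> t)" if "\<phi> \<in> schwartz" for \<phi>
    by (rule linear_growth_times_schwartz(1)[OF cont growth that])
  have D2: "has_D2 f (\<lambda>A. \<Sum>\<tau>\<in>T. a \<tau> * dirac \<tau> A)"
    unfolding has_D2_def
  proof (intro conjI ballI)
    show "finite_signed_measure (\<lambda>A. \<Sum>\<tau>\<in>T. a \<tau> * dirac \<tau> A)"
      by (rule finite_signed_measure_dirac_sum[OF T])
    fix \<phi> assume \<phi>: "\<phi> \<in> schwartz"
    note lin = integral_affine_times_deriv2[OF \<phi>, of c d] and hinge = integral_hinge_times_deriv2[OF \<phi>]
    have "distr_deriv (distr_deriv (distr_of_fun f)) \<phi>
        = integral\<^sup>L lborel (\<lambda>t. f t * deriv (deriv \<phi>) t)"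
      by (simp add: distr_deriv_def distr_of_fun_def)
    also have "\<dots> = integral\<^sup>L lborel (\<lambda>t. (c * t + d) * deriv (deriv \<phi>) t
        + (\<Sum>\<tau>\<in>T. a \<tau> * (max 0 (t - \<tau>) * deriv (deriv \<phi>) t)))"
      unfolding f_def distrib_right[of "c * _ + d"] sum_distrib_right mult.assoc ..
    also have "\<dots> = (\<Sum>\<tau>\<in>T. a \<tau> * \<phi> \<tau>)"
      using lin hinge by (subst Bochner_Integration.integral_add) (auto simp: Bochner_Integration.integral_sum)
    also have "\<dots> = signed_integral (\<lambda>A. \<Sum>\<tau>\<in>T. a \<tau> * dirac \<tau> A) \<phi>"
      using continuous_on_schwartz[OF \<phi>]
      by (intro signed_integral_dirac_sum(1)[OF T, symmetric] borel_measurable_continuous_onI)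
    finally show "distr_deriv (distr_deriv (distr_of_fun f)) \<phi>
        = signed_integral (\<lambda>A. \<Sum>\<tau>\<in>T. a \<tau> * dirac \<tau> A) \<phi>" .
  qed
  then show "f \<in> BV2"
    unfolding BV2_def using cont int tempered_distribution_linear_growth[OF cont growth] by blast
  show "D2 f = (\<lambda>A. \<Sum>\<tau>\<in>T. a \<tau> * dirac \<tau> A)"
    by (rule D2_eq[OF cont int D2])
qed

text \<open>
  The knots in the list may repeat and the weights at a knot may cancel, so the spline
  can have fewer knots than the list has entries.
\<close>

lemma linear_spline_of_list:
  fixes l :: "(real \<times> real) list" and c d :: real
  defines "f \<equiv> \<lambda>t. c * t + d + (\<Sum>(w, \<tau>)\<leftarrow>l. w * max 0 (t - \<tau>))"
  shows "\<exists>K \<le> length l. pl_spline_with_sparsity f K" and "tv_norm (D2 f) \<le> (\<Sum>(w, \<tau>)\<leftarrow>l. \<bar>w\<bar>)"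
proof -
  define a where "a = (\<lambda>l \<tau>. \<Sum>(w, \<tau>')\<leftarrow>l. if \<tau>' = (\<tau> :: real) then w else (0 :: real))"
  define T where "T = {\<tau> \<in> snd ` set l. a l \<tau> \<noteq> 0}"
  have T: "finite T" "card T \<le> length l"
  proof -
    show "finite T" by (simp add: T_def)
    have "card T \<le> card (snd ` set l)" by (intro card_mono) (auto simp: T_def)
    also have "\<dots> \<le> card (set l)" by (intro card_image_le) simp
    also have "\<dots> \<le> length l" by (rule card_length)
    finally show "card T \<le> length l" .
  qed
  have regroup: "(\<Sum>(w, \<tau>)\<leftarrow>l. w * g \<tau>) = (\<Sum>\<tau>\<in>T. a l \<tau> * g \<tau>)" for g :: "real \<Rightarrow> real"
  proof -
    have "(\<Sum>(w, \<tau>)\<leftarrow>k. w * g \<tau>) = (\<Sum>\<tau>\<in>U. a k \<tau> * g \<tau>)" if "finite U" "snd ` set k \<subseteq> U" for k U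
      using that(2)
    proof (induction k)
      case (Cons p k)
      obtain w \<tau>0 where p: "p = (w, \<tau>0)" by (cases p)
      have "(\<Sum>\<tau>\<in>U. a (p # k) \<tau> * g \<tau>) = (\<Sum>\<tau>\<in>U. (if \<tau> = \<tau>0 then w * g \<tau> else 0) + a k \<tau> * g \<tau>)"
        by (intro sum.cong) (auto simp: a_def p distrib_right)
      also have "\<dots> = w * g \<tau>0 + (\<Sum>\<tau>\<in>U. a k \<tau> * g \<tau>)"
        using Cons.prems that(1) by (simp add: sum.distrib p)
      finally show ?case using Cons by (simp add: p)
    qed (simp add: a_def)
    from this[of "snd ` set l" l] have "(\<Sum>(w, \<tau>)\<leftarrow>l. w * g \<tau>) = (\<Sum>\<tau>\<in>snd ` set l. a l \<tau> * g \<tau>)"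
      by simp
    also have "\<dots> = (\<Sum>\<tau>\<in>T. a l \<tau> * g \<tau>)"
      unfolding T_def by (intro sum.mono_neutral_right) auto
    finally show ?thesis .
  qed
  have f: "f = (\<lambda>t. c * t + d + (\<Sum>\<tau>\<in>T. a l \<tau> * max 0 (t - \<tau>)))"
    unfolding f_def regroup ..
  have D2: "D2 f = (\<lambda>A. \<Sum>\<tau>\<in>T. a l \<tau> * dirac \<tau> A)" and BV: "f \<in> BV2"
    unfolding f by (rule D2_linear_spline[OF T(1)], rule linear_spline_in_BV2[OF T(1)])
  have "pl_spline_with_sparsity f (card T)"
    unfolding pl_spline_with_sparsity_def using BV D2 T(1)
    by (intro conjI exI[of _ T] exI[of _ "a l"]) (simp_all add: T_def)
  with T(2) show "\<exists>K \<le> length l. pl_spline_with_sparsity f K" by blast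
  \<comment> \<open>written with \<open>sgn\<close>, the sum over the knots is linear in the weights and can be regrouped along the list\<close>
  have "tv_norm (D2 f) = (\<Sum>\<tau>\<in>T. a l \<tau> * sgn (a l \<tau>))"
    unfolding D2 signed_integral_dirac_sum(2)[OF T(1) borel_measurable_const] by (simp add: abs_sgn)
  also have "\<dots> = (\<Sum>(w, \<tau>)\<leftarrow>l. w * sgn (a l \<tau>))" by (rule regroup[symmetric])
  also have "\<dots> \<le> (\<Sum>(w, \<tau>)\<leftarrow>l. \<bar>w\<bar>)"
    by (intro sum_list_mono) (auto simp: sgn_real_def)
  finally show "tv_norm (D2 f) \<le> (\<Sum>(w, \<tau>)\<leftarrow>l. \<bar>w\<bar>)" .
qed

section \<open>Knots of an interpolant of minimal variation\<close>

lemma sum_hats_le_1: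
  fixes x :: "nat \<Rightarrow> real"
  assumes x: "strict_mono_on {1..M} x" and M: "M \<ge> 2"
  shows "(\<Sum>m=2..M-1. hat (x (m - 1)) (x m) (x (m + 1)) t) \<le> 1"
proof -
  have tele: "(\<Sum>m\<in>{2..<n + 2}. hat (x (m - 1)) (x m) (x (m + 1)) t)
      = ramp (x 1) (x 2) t - ramp (x (n + 1)) (x (n + 2)) t" for n
  proof (induction n)
    case 0
    then show ?case by (simp add: numeral_2_eq_2)
  next
    case (Suc n)
    have "{2..<Suc n + 2} = insert (n + 2) {2..<n + 2}" by auto
    then show ?case using Suc by (simp add: hat_def)
  qed
  have lt: "x i < x j" if "1 \<le> i" "i < j" "j \<le> M" for i j
    using that by (intro strict_mono_onD[OF x]) auto
  have "{2..M-1} = {2..<(M - 2) + 2}" using M by auto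
  then have "(\<Sum>m=2..M-1. hat (x (m - 1)) (x m) (x (m + 1)) t)
      = ramp (x 1) (x 2) t - ramp (x (M - 2 + 1)) (x (M - 2 + 2)) t"
    by (simp only: tele)
  also have "\<dots> \<le> 1"
  proof -
    have "x 1 < x 2" "x (M - 2 + 1) < x (M - 2 + 2)" using M by (auto intro!: lt)
    then show ?thesis
      using ramp_le_1[of "x 1" "x 2" t] ramp_nonneg[of "x (M - 2 + 1)" "x (M - 2 + 2)" t] by linarith
  qed
  finally show ?thesis .
qed

lemma abs_sum_hats_le_1:
  fixes x :: "nat \<Rightarrow> real"
  assumes x: "strict_mono_on {1..M} x" and M: "M \<ge> 2" and e: "\<And>m. \<bar>e m\<bar> \<le> (1 :: real)"
  shows "\<bar>\<Sum>m=2..M-1. e m * hat (x (m - 1)) (x m) (x (m + 1)) t\<bar> \<le> 1"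
proof -
  have h: "0 \<le> hat (x (m - 1)) (x m) (x (m + 1)) t" if "m \<in> {2..M-1}" for m
    using that M by (intro hat_nonneg strict_mono_onD[OF x]) auto
  have "\<bar>\<Sum>m=2..M-1. e m * hat (x (m - 1)) (x m) (x (m + 1)) t\<bar>
      \<le> (\<Sum>m=2..M-1. hat (x (m - 1)) (x m) (x (m + 1)) t)"
    using h e by (intro order_trans[OF sum_abs] sum_mono) (simp add: abs_mult mult_left_le_one_le)
  also have "\<dots> \<le> 1" by (rule sum_hats_le_1[OF x M])
  finally show ?thesis .
qed

lemma abs_coeff_sign_le_1: "\<bar>coeff_sign M x z m\<bar> \<le> 1"
  by (simp add: coeff_sign_def sgn_real_def)

lemma coeff_sign_cases: "coeff_sign M x z m \<noteq> 0 \<Longrightarrow> coeff_sign M x z m \<in> {1, -1}"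
  by (auto simp: coeff_sign_def sgn_real_def split: if_split_asm)

lemma L_op_eq_pl_coeff: "i \<ge> 1 \<Longrightarrow> L_op x z i = pl_coeff x z (i + 1)"
  by (simp add: L_op_def pl_coeff_def inv_gap_def diff_divide_distrib add_divide_distrib algebra_simps)

lemma sum_abs_L_op:
  assumes "M \<ge> 2"
  shows "(\<Sum>i=1..M-2. \<bar>L_op x z i\<bar>) = (\<Sum>m=2..M-1. \<bar>pl_coeff x z m\<bar>)"
proof -
  have "(\<Sum>i=1..M-2. \<bar>L_op x z i\<bar>) = (\<Sum>i=1..M-2. \<bar>pl_coeff x z (Suc i)\<bar>)"
    by (intro sum.cong) (auto simp: L_op_eq_pl_coeff)
  also have "\<dots> = (\<Sum>m=Suc 1..Suc (M-2). \<bar>pl_coeff x z m\<bar>)"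
    by (rule sum.shift_bounds_cl_Suc_ivl[symmetric])
  finally show ?thesis using assms by (simp add: numeral_2_eq_2 Suc_diff_Suc)
qed

text \<open>
  The integral of the signed sum of hat functions with signs \<open>e\<^sub>m\<close> is both \<open>\<Sum> \<bar>a\<^sub>m\<bar>\<close>, by the Peano
  formula, and at most the total variation, since this sum has absolute value at most 1.
\<close>

lemma
  assumes x: "strict_mono_on {1..M} x" and M: "M \<ge> 2"
    and g: "g \<in> BV2" "\<And>m. m \<in> {1..M} \<Longrightarrow> g (x m) = z m"
  shows pl_coeff_eq_signed_integral: "m \<in> {2..M-1} \<Longrightarrow>
      pl_coeff x z m = signed_integral (D2 g) (hat (x (m - 1)) (x m) (x (m + 1)))"
    and sum_abs_pl_coeff_eq_signed_integral: "(\<Sum>m=2..M-1. \<bar>pl_coeff x z m\<bar>) =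
      signed_integral (D2 g) (\<lambda>t. \<Sum>m=2..M-1. coeff_sign M x z m * hat (x (m - 1)) (x m) (x (m + 1)) t)"
    and sum_abs_pl_coeff_le_tv_norm: "(\<Sum>m=2..M-1. \<bar>pl_coeff x z m\<bar>) \<le> tv_norm (D2 g)"
proof -
  have fsm: "finite_signed_measure (D2 g)"
    using BV2_has_D2[OF g(1)] by (simp add: has_D2_def)
  have lt: "x i < x j" if "1 \<le> i" "i < j" "j \<le> M" for i j
    using that by (intro strict_mono_onD[OF x]) auto
  show a: "pl_coeff x z m = signed_integral (D2 g) (hat (x (m - 1)) (x m) (x (m + 1)))"
    if m: "m \<in> {2..M-1}" for m
  proof -
    have "signed_integral (D2 g) (hat (x (m - 1)) (x m) (x (m + 1)))
        = slope g (x m) (x (m + 1)) - slope g (x (m - 1)) (x m)"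
      using m by (intro BV2_divided_difference[OF g(1)] lt) auto
    moreover have "m - 1 \<in> {1..M}" "m \<in> {1..M}" "m + 1 \<in> {1..M}" using m by auto
    ultimately show ?thesis
      using m by (simp add: g(2) slope_def pl_coeff_def)
  qed
  have hat_bd: "\<bar>coeff_sign M x z m * hat (x (m - 1)) (x m) (x (m + 1)) t\<bar> \<le> 1" if "m \<in> {2..M-1}" for m t
    using that lt abs_hat_le_1[of "x (m - 1)" "x m" "x (m + 1)" t] abs_coeff_sign_le_1[of M x z m]
    by (auto simp: abs_mult intro!: mult_le_one)
  have "(\<Sum>m=2..M-1. \<bar>pl_coeff x z m\<bar>) = (\<Sum>m=2..M-1. coeff_sign M x z m * pl_coeff x z m)"
    by (intro sum.cong) (auto simp: coeff_sign_def sgn_real_def)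
  also have "\<dots> = (\<Sum>m=2..M-1. signed_integral (D2 g) (\<lambda>t. coeff_sign M x z m * hat (x (m - 1)) (x m) (x (m + 1)) t))"
    by (intro sum.cong) (auto simp: a signed_integral_scale)
  also have "\<dots> = signed_integral (D2 g) (\<lambda>t. \<Sum>m=2..M-1. coeff_sign M x z m * hat (x (m - 1)) (x m) (x (m + 1)) t)"
    by (rule signed_integral_sum[OF fsm, symmetric, where B = 1]) (use hat_bd in auto)
  finally show eq: "(\<Sum>m=2..M-1. \<bar>pl_coeff x z m\<bar>) =
      signed_integral (D2 g) (\<lambda>t. \<Sum>m=2..M-1. coeff_sign M x z m * hat (x (m - 1)) (x m) (x (m + 1)) t)" .
  have "\<bar>signed_integral (D2 g) (\<lambda>t. \<Sum>m=2..M-1. coeff_sign M x z m * hat (x (m - 1)) (x m) (x (m + 1)) t)\<bar>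
      \<le> tv_norm (D2 g)"
    by (rule abs_signed_integral_le_tv_norm[OF fsm])
      (measurable, rule abs_sum_hats_le_1[OF x M abs_coeff_sign_le_1])
  then show "(\<Sum>m=2..M-1. \<bar>pl_coeff x z m\<bar>) \<le> tv_norm (D2 g)" using eq by linarith
qed

lemma abs_signed_sum_less_1:
  fixes e h :: "'a \<Rightarrow> real"
  assumes A: "finite A" "i \<in> A" "j \<in> A" and h: "\<And>k. k \<in> A \<Longrightarrow> 0 \<le> h k" "sum h A \<le> 1"
    and e: "\<And>k. k \<in> A \<Longrightarrow> \<bar>e k\<bar> \<le> 1" and opp: "e j = - e i" "i \<noteq> j" and pos: "0 < h i" "0 < h j"
  shows "\<bar>\<Sum>k\<in>A. e k * h k\<bar> < 1"
proof -
  have split: "sum f A = f i + f j + sum f (A - {i, j})" for f :: "'a \<Rightarrow> real"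
    using A opp(2) by (subst sum.subset_diff[of "{i, j}"]) (auto simp: add.commute)
  have "\<bar>\<Sum>k\<in>A - {i, j}. e k * h k\<bar> \<le> sum h (A - {i, j})"
    using h(1) e by (intro order_trans[OF sum_abs] sum_mono) (auto simp: abs_mult intro!: mult_left_le_one_le)
  moreover have "\<bar>e i * h i + e j * h j\<bar> < h i + h j"
  proof -
    have "\<bar>e i * h i + e j * h j\<bar> = \<bar>e i\<bar> * \<bar>h i - h j\<bar>"
      using opp(1) by (simp add: abs_mult[symmetric] right_diff_distrib)
    also have "\<dots> \<le> 1 * \<bar>h i - h j\<bar>" using e A by (intro mult_right_mono) auto
    also have "\<dots> < h i + h j" using pos by auto
    finally show ?thesis .
  qed
  ultimately show ?thesis
    using h(2) unfolding split[of "\<lambda>k. e k * h k"] split[of h] by linarith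
qed

text \<open>
  Equality in \<open>\<Sum> \<bar>a\<^sub>m\<bar> \<le> \<Sum> \<bar>b\<^sub>\<tau>\<bar>\<close> forces the signed sum of hats to have modulus 1 at every knot. So a
  knot cannot lie strictly between neighbouring nodes with opposite signs. Each node in \<open>I\<close> needs a
  knot in the interior of the support of its hat, and no two nodes in \<open>I\<close> can share one: overlapping supports
  belong to neighbouring nodes, which then have opposite signs.
\<close>

lemma card_le_sparsity_if_minimal_variation:
  assumes x: "strict_mono_on {1..M} x" and M: "M \<ge> 2"
    and g: "pl_spline_with_sparsity g K" "\<And>m. m \<in> {1..M} \<Longrightarrow> g (x m) = z m"
    and tv: "tv_norm (D2 g) \<le> (\<Sum>m=2..M-1. \<bar>pl_coeff x z m\<bar>)"
    and I: "I \<subseteq> {2..M-1}" "\<And>m. m \<in> I \<Longrightarrow> coeff_sign M x z m \<noteq> 0"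
      "\<And>m. m \<in> I \<Longrightarrow> m + 1 \<in> I \<Longrightarrow> coeff_sign M x z m \<noteq> coeff_sign M x z (m + 1)"
  shows "card I \<le> K"
proof -
  define h where "h = (\<lambda>m. hat (x (m - 1)) (x m) (x (m + 1)))"
  define e where "e = coeff_sign M x z"
  define u where "u = (\<lambda>t. \<Sum>m=2..M-1. e m * h m t)"
  obtain T b where T: "finite T" "card T = K" "\<And>\<tau>. \<tau> \<in> T \<Longrightarrow> b \<tau> \<noteq> 0"
    and D2: "D2 g = (\<lambda>A. \<Sum>\<tau>\<in>T. b \<tau> * dirac \<tau> A)" and BV: "g \<in> BV2"
    using g(1) unfolding pl_spline_with_sparsity_def by blast
  have lt: "x i < x j" if "1 \<le> i" "i < j" "j \<le> M" for i j
    using that by (intro strict_mono_onD[OF x]) auto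
  have hpos: "0 < h m t \<longleftrightarrow> x (m - 1) < t \<and> t < x (m + 1)" if "m \<in> {2..M-1}" for m t
    unfolding h_def using that by (intro hat_pos_iff lt) auto
  have h0: "0 \<le> h m t" if "m \<in> {2..M-1}" for m t
    unfolding h_def using that by (intro hat_nonneg lt) auto
  have meas: "h m \<in> borel_measurable borel" "u \<in> borel_measurable borel" for m
    unfolding u_def h_def by measurable
  have u1: "\<bar>u t\<bar> \<le> 1" for t
    unfolding u_def h_def e_def by (rule abs_sum_hats_le_1[OF x M abs_coeff_sign_le_1])
  have a: "pl_coeff x z m = (\<Sum>\<tau>\<in>T. b \<tau> * h m \<tau>)" if "m \<in> {2..M-1}" for m
    using pl_coeff_eq_signed_integral[OF x M BV g(2) that] signed_integral_dirac_sum(1)[OF T(1) meas(1)]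
    by (simp add: D2 h_def)
  have "(\<Sum>\<tau>\<in>T. \<bar>b \<tau>\<bar>) \<le> (\<Sum>\<tau>\<in>T. b \<tau> * u \<tau>)"
    using tv sum_abs_pl_coeff_eq_signed_integral[OF x M BV g(2)] signed_integral_dirac_sum[OF T(1) meas(2)]
    by (simp add: D2 u_def h_def e_def)
  moreover have le: "b \<tau> * u \<tau> \<le> \<bar>b \<tau>\<bar>" for \<tau>
  proof -
    have "b \<tau> * u \<tau> \<le> \<bar>b \<tau>\<bar> * \<bar>u \<tau>\<bar>" by (simp flip: abs_mult)
    also have "\<dots> \<le> \<bar>b \<tau>\<bar>" using u1[of \<tau>] by (intro mult_left_le) auto
    finally show ?thesis .
  qed
  ultimately have "(\<Sum>\<tau>\<in>T. \<bar>b \<tau>\<bar> - b \<tau> * u \<tau>) = 0"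
    using sum_nonneg[of T "\<lambda>\<tau>. \<bar>b \<tau>\<bar> - b \<tau> * u \<tau>"] by (simp add: sum_subtractf)
  then have eq: "\<bar>b \<tau>\<bar> = b \<tau> * u \<tau>" if "\<tau> \<in> T" for \<tau>
    using sum_nonneg_eq_0_iff[OF T(1), of "\<lambda>\<tau>. \<bar>b \<tau>\<bar> - b \<tau> * u \<tau>"] le that by simp
  have unit: "\<bar>u \<tau>\<bar> = 1" if "\<tau> \<in> T" for \<tau>
    using arg_cong[OF eq[OF that], of abs] T(3)[OF that] by (simp add: abs_mult)
  have "\<exists>\<tau>\<in>T. 0 < h m \<tau>" if m: "m \<in> I" for m
  proof (rule ccontr)
    assume "\<not> (\<exists>\<tau>\<in>T. 0 < h m \<tau>)"
    then have "h m \<tau> = 0" if "\<tau> \<in> T" for \<tau>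
      using that h0[of m \<tau>] m I(1) by (force simp: not_less)
    then have "pl_coeff x z m = 0" using a[of m] m I(1) by auto
    then show False using I(2)[OF m] by (simp add: coeff_sign_def split: if_splits)
  qed
  then obtain knot where knot: "\<And>m. m \<in> I \<Longrightarrow> knot m \<in> T \<and> 0 < h m (knot m)" by metis
  have ne: "knot m \<noteq> knot n" if mn: "m \<in> I" "n \<in> I" "m < n" for m n
  proof
    assume same: "knot m = knot n"
    let ?\<tau> = "knot m"
    have pos: "0 < h m ?\<tau>" "0 < h n ?\<tau>" using knot[OF mn(1)] knot[OF mn(2)] unfolding same by blast+
    have mem: "m \<in> {2..M-1}" "n \<in> {2..M-1}" using mn I(1) by auto
    have "x (n - 1) < x (m + 1)" using pos hpos mem by fastforce
    moreover have "x (m + 1) \<le> x (n - 1)" if "m + 1 \<le> n - 1"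
      using that mem by (intro strict_mono_on_leD[OF x]) auto
    ultimately have "\<not> m + 1 \<le> n - 1" by (meson not_less)
    then have n: "n = m + 1" using mn(3) by auto
    have "e m \<noteq> e n" unfolding e_def n using I(3)[of m] mn n by simp
    moreover have "e m \<in> {1, -1}" "e n \<in> {1, -1}"
      unfolding e_def using coeff_sign_cases[OF I(2)] mn by blast+
    ultimately have "e n = - e m" by auto
    then have "\<bar>u ?\<tau>\<bar> < 1"
      unfolding u_def using mem h0 pos sum_hats_le_1[OF x M, of ?\<tau>] abs_coeff_sign_le_1[of M x z] n
      by (intro abs_signed_sum_less_1[where i = m and j = n]) (auto simp: h_def e_def)
    then show False using unit[of ?\<tau>] knot[OF mn(1)] by simp
  qed
  have "inj_on knot I"
    by (rule linorder_inj_onI) (use ne in auto)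
  then show ?thesis
    using card_inj_on_le[of knot I T] knot T(1,2) by blast
qed

section \<open>Blocks of constant sign\<close>

lemma block_start_bounds:
  assumes "s \<in> block_starts M x z"
  shows "2 \<le> s" "s \<le> M - 1" "coeff_sign M x z s \<noteq> 0"
    "coeff_sign M x z s \<noteq> coeff_sign M x z (s - 1)"
  using assms by (auto simp: block_starts_def)

lemma finite_block_starts [simp]: "finite (block_starts M x z)"
  by (rule finite_subset[of _ "{2..M-1}"]) (auto simp: block_starts_def)

lemma
  assumes s: "s \<in> block_starts M x z"
  shows block_end: "coeff_sign M x z (s + block_alpha M x z s + 1) \<noteq> coeff_sign M x z s"
    and block_sign: "j \<le> block_alpha M x z s \<Longrightarrow> coeff_sign M x z (s + j) = coeff_sign M x z s"
    and block_bound: "s + block_alpha M x z s \<le> M - 1"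
proof -
  let ?e = "coeff_sign M x z"
  have "s + (M - 1 - s) + 1 = M" "?e M = 0"
    using block_start_bounds[OF s] by (auto simp: coeff_sign_def)
  then have "?e (s + (M - 1 - s) + 1) \<noteq> ?e s"
    using block_start_bounds(3)[OF s] by metis
  then show "?e (s + block_alpha M x z s + 1) \<noteq> ?e s"
    unfolding block_alpha_def by (rule LeastI)
  show sign: "?e (s + j) = ?e s" if j: "j \<le> block_alpha M x z s" for j
  proof (cases j)
    case (Suc k)
    then have "k < block_alpha M x z s" using j by simp
    then show ?thesis unfolding block_alpha_def Suc by (auto dest: not_less_Least)
  qed simp
  have "?e (s + block_alpha M x z s) \<noteq> 0"
    using sign[of "block_alpha M x z s"] block_start_bounds(3)[OF s] by simp
  then show "s + block_alpha M x z s \<le> M - 1"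
    by (simp add: coeff_sign_def split: if_splits)
qed

lemma block_before_next_start:
  assumes "s \<in> block_starts M x z" "s' \<in> block_starts M x z" "s < s'"
  shows "s + block_alpha M x z s < s'"
proof (rule ccontr)
  assume "\<not> ?thesis"
  then have "coeff_sign M x z (s + (s' - s)) = coeff_sign M x z s"
      "coeff_sign M x z (s + (s' - s - 1)) = coeff_sign M x z s"
    using assms(3) by (intro block_sign[OF assms(1)]; simp)+
  then have "coeff_sign M x z s' = coeff_sign M x z (s' - 1)"
    using assms(3) by (simp add: Suc_leI)
  then show False using block_start_bounds(4)[OF assms(2)] by simp
qed

text \<open>
  The block is found by going left from \<open>m\<close> as long as the sign stays the same.
\<close>

lemma in_some_block:
  assumes m: "coeff_sign M x z m \<noteq> 0"
  shows "\<exists>s\<in>block_starts M x z. m \<in> {s..s + block_alpha M x z s}"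
proof -
  let ?e = "coeff_sign M x z"
  define P where "P = (\<lambda>s. s \<le> m \<and> (\<forall>i\<in>{s..m}. ?e i = ?e m))"
  define s where "s = (LEAST s. P s)"
  have "P m" by (simp add: P_def)
  then have s: "P s" unfolding s_def by (rule LeastI)
  then have const: "?e i = ?e m" if "i \<in> {s..m}" for i using that unfolding P_def by blast
  have sm: "s \<le> m" using s unfolding P_def by blast
  then have es: "?e s = ?e m" by (intro const) simp
  have rng: "2 \<le> s" "s \<le> M - 1" using es m by (auto simp: coeff_sign_def split: if_splits)
  have "?e (s - 1) \<noteq> ?e s"
  proof
    assume *: "?e (s - 1) = ?e s"
    have "?e i = ?e m" if "i \<in> {s - 1..m}" for i
    proof (cases "i = s - 1")
      case True
      then show ?thesis using * es by simp
    next
      case False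
      then have "i \<in> {s..m}" using that by auto
      then show ?thesis by (rule const)
    qed
    moreover have "s - 1 \<le> m" using sm by simp
    ultimately have "P (s - 1)" unfolding P_def by blast
    then have "s \<le> s - 1" unfolding s_def by (rule Least_le)
    then show False using rng by simp
  qed
  moreover have "?e s \<in> {1, -1}" using es m by (metis coeff_sign_cases)
  ultimately have start: "s \<in> block_starts M x z" using rng by (auto simp: block_starts_def)
  have "m \<le> s + block_alpha M x z s"
  proof (rule ccontr)
    assume "\<not> ?thesis"
    then have "?e (s + block_alpha M x z s + 1) = ?e m" by (intro const) simp
    then show False using block_end[OF start] es by simp
  qed
  then show ?thesis using start sm by auto
qed

lemma sum_over_blocks:
  fixes G :: "nat \<Rightarrow> real"
  assumes "\<And>m. m \<in> {2..M-1} \<Longrightarrow> coeff_sign M x z m = 0 \<Longrightarrow> G m = 0"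
  shows "(\<Sum>s\<in>block_starts M x z. \<Sum>m=s..s + block_alpha M x z s. G m) = (\<Sum>m=2..M-1. G m)"
proof -
  let ?B = "\<lambda>s. {s..s + block_alpha M x z s}"
  have "(\<Sum>s\<in>block_starts M x z. sum G (?B s)) = sum G (\<Union>s\<in>block_starts M x z. ?B s)"
  proof (rule sum.UNION_disjoint[symmetric])
    show "\<forall>s\<in>block_starts M x z. \<forall>s'\<in>block_starts M x z. s \<noteq> s' \<longrightarrow> ?B s \<inter> ?B s' = {}"
    proof (intro ballI impI)
      fix s s' assume "s \<in> block_starts M x z" "s' \<in> block_starts M x z" "s \<noteq> s'"
      then show "?B s \<inter> ?B s' = {}"
        using block_before_next_start[of s M x z s'] block_before_next_start[of s' M x z s]
        by (cases s s' rule: linorder_cases) auto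
    qed
  qed auto
  also have "\<dots> = (\<Sum>m=2..M-1. G m)"
  proof (rule sum.mono_neutral_left)
    show "(\<Union>s\<in>block_starts M x z. ?B s) \<subseteq> {2..M-1}"
      using block_start_bounds(1) block_bound by fastforce
    show "\<forall>m\<in>{2..M-1} - (\<Union>s\<in>block_starts M x z. ?B s). G m = 0"
      using in_some_block assms by blast
  qed simp
  finally show ?thesis .
qed

lemma ceiling_half: "nat \<lceil>real (n + 1) / 2\<rceil> = n div 2 + 1"
  by (cases "even n") (auto elim!: evenE oddE simp: ceiling_eq_iff nat_eq_iff)

lemma K_min_eq: "K_min M x z = (\<Sum>s\<in>block_starts M x z. block_alpha M x z s div 2 + 1)"
  unfolding K_min_def by (simp only: ceiling_half)

text \<open>
  One node for each knot that a block needs. Two neighbours within a block are never both chosen, and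
  chosen neighbours from different blocks have opposite signs, so no two of these nodes can share a knot
  of an interpolating spline of minimal variation.
\<close>

definition alternate_nodes :: "nat \<Rightarrow> (nat \<Rightarrow> real) \<Rightarrow> (nat \<Rightarrow> real) \<Rightarrow> nat set" where
  "alternate_nodes M x z =
     (\<Union>s\<in>block_starts M x z. (\<lambda>i. s + 2 * i) ` {..block_alpha M x z s div 2})"

lemma alternate_nodesE:
  assumes "m \<in> alternate_nodes M x z"
  obtains s i where "s \<in> block_starts M x z" "m = s + 2 * i" "2 * i \<le> block_alpha M x z s"
proof -
  obtain s i where "s \<in> block_starts M x z" "i \<le> block_alpha M x z s div 2" "m = s + 2 * i"
    using assms unfolding alternate_nodes_def by auto
  then show thesis by (intro that[of s i]) auto
qed

lemma card_alternate_nodes: "card (alternate_nodes M x z) = K_min M x z"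
  unfolding alternate_nodes_def K_min_eq
proof (subst card_UN_disjoint)
  show "\<forall>s\<in>block_starts M x z. \<forall>s'\<in>block_starts M x z. s \<noteq> s' \<longrightarrow>
      (\<lambda>i. s + 2 * i) ` {..block_alpha M x z s div 2} \<inter> (\<lambda>i. s' + 2 * i) ` {..block_alpha M x z s' div 2} = {}"
  proof (intro ballI impI)
    fix s s' assume "s \<in> block_starts M x z" "s' \<in> block_starts M x z" "s \<noteq> s'"
    then show "(\<lambda>i. s + 2 * i) ` {..block_alpha M x z s div 2} \<inter>
        (\<lambda>i. s' + 2 * i) ` {..block_alpha M x z s' div 2} = {}"
      using block_before_next_start[of s M x z s'] block_before_next_start[of s' M x z s]
      by (cases s s' rule: linorder_cases) auto
  qed
qed (auto simp: card_image inj_on_def)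

lemma alternate_nodes_subset: "alternate_nodes M x z \<subseteq> {2..M-1}"
proof
  fix m assume "m \<in> alternate_nodes M x z"
  then obtain s i where "s \<in> block_starts M x z" "m = s + 2 * i" "2 * i \<le> block_alpha M x z s"
    by (rule alternate_nodesE)
  then show "m \<in> {2..M-1}"
    using block_start_bounds(1)[of s M x z] block_bound[of s M x z] by auto
qed

lemma coeff_sign_alternate_node:
  assumes "m \<in> alternate_nodes M x z"
  shows "coeff_sign M x z m \<noteq> 0"
  using assms by (rule alternate_nodesE) (metis block_sign block_start_bounds(3))

lemma coeff_sign_adjacent_alternate_nodes:
  assumes "m \<in> alternate_nodes M x z" "m + 1 \<in> alternate_nodes M x z"
  shows "coeff_sign M x z m \<noteq> coeff_sign M x z (m + 1)"
proof -
  obtain s i where s: "s \<in> block_starts M x z" "m = s + 2 * i" "2 * i \<le> block_alpha M x z s"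
    using assms(1) by (rule alternate_nodesE)
  obtain s' i' where s': "s' \<in> block_starts M x z" "m + 1 = s' + 2 * i'" "2 * i' \<le> block_alpha M x z s'"
    using assms(2) by (rule alternate_nodesE)
  have "s \<noteq> s'"
  proof
    assume "s = s'"
    then have "2 * i + 1 = 2 * i'" using s(2) s'(2) by simp
    then show False by presburger
  qed
  moreover have "\<not> s' < s"
    using block_before_next_start[OF s'(1) s(1)] s s' by auto
  ultimately have "s < s'" by simp
  then have "m + 1 = s'"
    using block_before_next_start[OF s(1) s'(1)] s s' by auto
  then show ?thesis using block_start_bounds(4)[OF s'(1)] by auto
qed

section \<open>The sparsified spline\<close>

lemma sum_consecutive_pairs:
  fixes G :: "nat \<Rightarrow> real"
  shows "(\<Sum>i<n. G (s + 2 * i) + G (s + 2 * i + 1)) = sum G {s..<s + 2 * n}"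
  by (induction n) (simp_all add: algebra_simps)

lemma sum_list_block_pairs:
  fixes G :: "nat \<Rightarrow> real"
  assumes single: "g (pl_coeff x z s, x s) = G s"
    and pair: "\<And>m. s \<le> m \<Longrightarrow> m < s + block_alpha M x z s \<Longrightarrow> g (merge_pair x z m) = G m + G (m + 1)"
  shows "(\<Sum>p\<leftarrow>block_pairs M x z s. g p) = (\<Sum>m=s..s + block_alpha M x z s. G m)"
proof (cases "odd (block_alpha M x z s)")
  case True
  then obtain k where k: "block_alpha M x z s = 2 * k + 1" by (rule oddE)
  have "(\<Sum>p\<leftarrow>block_pairs M x z s. g p) = (\<Sum>i<k + 1. g (merge_pair x z (s + 2 * i)))"
    by (simp add: block_pairs_def k comp_def interv_sum_list_conv_sum_set_nat atLeast0LessThan del: upt_Suc)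
  also have "\<dots> = (\<Sum>i<k + 1. G (s + 2 * i) + G (s + 2 * i + 1))"
    by (intro sum.cong refl pair) (auto simp: k)
  also have "\<dots> = sum G {s..<s + 2 * (k + 1)}" by (rule sum_consecutive_pairs)
  also have "{s..<s + 2 * (k + 1)} = {s..s + block_alpha M x z s}" by (auto simp: k)
  finally show ?thesis .
next
  case False
  then obtain k where k: "block_alpha M x z s = 2 * k" by (metis evenE)
  have "(\<Sum>p\<leftarrow>block_pairs M x z s. g p) = G s + (\<Sum>i\<in>{1..<k + 1}. g (merge_pair x z (s + 2 * i - 1)))"
    by (simp add: block_pairs_def k comp_def single interv_sum_list_conv_sum_set_nat del: upt_Suc)
  also have "(\<Sum>i\<in>{1..<k + 1}. g (merge_pair x z (s + 2 * i - 1))) = (\<Sum>i<k. g (merge_pair x z (Suc s + 2 * i)))"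
    using sum.shift_bounds_Suc_ivl[of "\<lambda>i. g (merge_pair x z (s + 2 * i - 1))" 0 k]
    by (simp add: atLeast0LessThan)
  also have "\<dots> = (\<Sum>i<k. G (Suc s + 2 * i) + G (Suc s + 2 * i + 1))"
    by (intro sum.cong refl pair) (auto simp: k)
  also have "\<dots> = sum G {Suc s..<Suc s + 2 * k}" by (rule sum_consecutive_pairs)
  also have "G s + \<dots> = sum G {s..<Suc s + 2 * k}"
    by (simp add: sum.atLeast_Suc_lessThan)
  also have "{s..<Suc s + 2 * k} = {s..s + block_alpha M x z s}" by (auto simp: k)
  finally show ?thesis .
qed

lemma length_block_pairs: "length (block_pairs M x z s) = block_alpha M x z s div 2 + 1"
  by (simp add: block_pairs_def Let_def)

lemma sum_list_over_starts:
  fixes F :: "nat \<Rightarrow> 'a :: comm_monoid_add"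
  shows "(\<Sum>s\<leftarrow>sorted_list_of_set (block_starts M x z). F s) = (\<Sum>s\<in>block_starts M x z. F s)"
  by (simp add: sum_list_distinct_conv_sum_set)

lemma length_sparsify_pairs: "length (sparsify_pairs M x z) = K_min M x z"
  by (simp add: sparsify_pairs_def K_min_eq length_concat comp_def length_block_pairs sum_list_over_starts)

text \<open>
  Any quantity that is preserved by merging two neighbours of equal sign has the same total over the
  algorithm's output as over the original hinges. This is used for the values at the nodes and for the
  absolute weights.
\<close>

lemma sum_list_sparsify_pairs:
  fixes G :: "nat \<Rightarrow> real"
  assumes single: "\<And>m. g (pl_coeff x z m, x m) = G m"
    and zero: "\<And>m. pl_coeff x z m = 0 \<Longrightarrow> G m = 0"
    and pair: "\<And>m. 2 \<le> m \<Longrightarrow> m + 1 \<le> M - 1 \<Longrightarrow> 0 < pl_coeff x z m * pl_coeff x z (m + 1) \<Longrightarrow>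
      g (merge_pair x z m) = G m + G (m + 1)"
  shows "(\<Sum>p\<leftarrow>sparsify_pairs M x z. g p) = (\<Sum>m=2..M-1. G m)"
proof -
  have "(\<Sum>p\<leftarrow>block_pairs M x z s. g p) = (\<Sum>m=s..s + block_alpha M x z s. G m)"
    if s: "s \<in> block_starts M x z" for s
  proof (rule sum_list_block_pairs)
    fix m assume m: "s \<le> m" "m < s + block_alpha M x z s"
    have "coeff_sign M x z (s + (m - s)) = coeff_sign M x z s"
      "coeff_sign M x z (s + (m + 1 - s)) = coeff_sign M x z s"
      using m by (intro block_sign[OF s]; simp)+
    then have "coeff_sign M x z m = coeff_sign M x z s" "coeff_sign M x z (m + 1) = coeff_sign M x z s"
      using m by simp_all
    then have sgn: "sgn (pl_coeff x z m) = sgn (pl_coeff x z (m + 1))" "pl_coeff x z m \<noteq> 0"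
        "2 \<le> m" "m + 1 \<le> M - 1"
      using block_start_bounds[OF s] by (auto simp: coeff_sign_def split: if_splits)
    then have "0 < pl_coeff x z m * pl_coeff x z (m + 1)"
      by (auto simp: zero_less_mult_iff sgn_real_def split: if_splits)
    then show "g (merge_pair x z m) = G m + G (m + 1)" using sgn by (intro pair)
  qed (rule single)
  then have blocks: "(\<Sum>s\<in>block_starts M x z. \<Sum>p\<leftarrow>block_pairs M x z s. g p)
      = (\<Sum>s\<in>block_starts M x z. \<Sum>m=s..s + block_alpha M x z s. G m)"
    by simp
  have "(\<Sum>p\<leftarrow>concat (map (block_pairs M x z) l). g p) = (\<Sum>s\<leftarrow>l. \<Sum>p\<leftarrow>block_pairs M x z s. g p)" for l
    by (induction l) simp_all
  then have "(\<Sum>p\<leftarrow>sparsify_pairs M x z. g p)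
      = (\<Sum>s\<in>block_starts M x z. \<Sum>m=s..s + block_alpha M x z s. G m)"
    by (simp only: sparsify_pairs_def sum_list_over_starts blocks)
  also have "\<dots> = (\<Sum>m=2..M-1. G m)"
    by (intro sum_over_blocks zero) (auto simp: coeff_sign_def sgn_eq_0_iff)
  finally show ?thesis .
qed

lemma sum_abs_weights_sparsify_pairs:
  "(\<Sum>(w, \<tau>)\<leftarrow>sparsify_pairs M x z. \<bar>w\<bar>) = (\<Sum>m=2..M-1. \<bar>pl_coeff x z m\<bar>)"
  by (rule sum_list_sparsify_pairs)
    (auto simp: merge_pair_def Let_def zero_less_mult_iff)

text \<open>
  The partial sums of the \<open>a\<^sub>m\<close> are the slopes of the interpolant.
\<close>

lemma linear_interpolation:
  assumes x: "strict_mono_on {1..M} x" and j: "j \<in> {1..M}"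
  shows "pl_coeff x z 1 * x j + affine_const x z + (\<Sum>m=2..M-1. pl_coeff x z m * max 0 (x j - x m)) = z j"
proof -
  define d where "d = (\<lambda>m. (z (m + 1) - z m) / (x (m + 1) - x m))"
  have a1: "pl_coeff x z 1 = d 1" by (simp add: pl_coeff_def d_def numeral_2_eq_2)
  have am: "pl_coeff x z m = d m - d (m - 1)" if "2 \<le> m" for m
    using that by (simp add: pl_coeff_def d_def)
  have mono: "x i \<le> x k" if "1 \<le> i" "i \<le> k" "k \<le> M" for i k
    using that by (intro strict_mono_on_leD[OF x]) auto
  have tele: "(\<Sum>m\<in>{2..<Suc n}. pl_coeff x z m) = d n - d 1" if "1 \<le> n" for n
    using that by (induction n rule: dec_induct) (simp_all add: am numeral_2_eq_2)
  have main: "d 1 * x n + affine_const x z + (\<Sum>m\<in>{2..<n}. pl_coeff x z m * (x n - x m)) = z n"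
    if "1 \<le> n" "n \<le> M" for n
    using that
  proof (induction n rule: dec_induct)
    case base
    then show ?case by (simp add: affine_const_def a1[unfolded One_nat_def])
  next
    case (step n)
    have gap: "x n < x (Suc n)" using step by (intro strict_mono_onD[OF x]) auto
    have "(\<Sum>m\<in>{2..<Suc n}. pl_coeff x z m * (x (Suc n) - x m))
        = (\<Sum>m\<in>{2..<Suc n}. pl_coeff x z m * (x n - x m)) + (\<Sum>m\<in>{2..<Suc n}. pl_coeff x z m) * (x (Suc n) - x n)"
      unfolding sum_distrib_right sum.distrib[symmetric]
      by (intro sum.cong refl) (simp add: algebra_simps)
    also have "(\<Sum>m\<in>{2..<Suc n}. pl_coeff x z m * (x n - x m)) = (\<Sum>m\<in>{2..<n}. pl_coeff x z m * (x n - x m))"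
      by (intro sum.mono_neutral_right) (auto simp: less_Suc_eq)
    finally have "d 1 * x (Suc n) + affine_const x z + (\<Sum>m\<in>{2..<Suc n}. pl_coeff x z m * (x (Suc n) - x m))
        = (d 1 * x n + affine_const x z + (\<Sum>m\<in>{2..<n}. pl_coeff x z m * (x n - x m)))
          + (d 1 + (\<Sum>m\<in>{2..<Suc n}. pl_coeff x z m)) * (x (Suc n) - x n)"
      by (simp add: algebra_simps del: sum.op_ivl_Suc)
    also have "\<dots> = z n + d n * (x (Suc n) - x n)"
      using step by (simp only: tele) simp
    also have "\<dots> = z (Suc n)" using gap by (simp add: d_def)
    finally show ?case .
  qed
  have "(\<Sum>m=2..M-1. pl_coeff x z m * max 0 (x j - x m)) = (\<Sum>m\<in>{2..<j}. pl_coeff x z m * max 0 (x j - x m))"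
  proof (rule sum.mono_neutral_right)
    show "\<forall>i\<in>{2..M-1} - {2..<j}. pl_coeff x z i * max 0 (x j - x i) = 0"
    proof
      fix i assume "i \<in> {2..M-1} - {2..<j}"
      then have "x j \<le> x i" using j by (intro mono) auto
      then show "pl_coeff x z i * max 0 (x j - x i) = 0" by simp
    qed
  qed (use j in auto)
  also have "\<dots> = (\<Sum>m\<in>{2..<j}. pl_coeff x z m * (x j - x m))"
    using j mono by (intro sum.cong) auto
  finally show ?thesis using main[of j] j a1 by simp
qed

text \<open>
  Merging two hinges of the same sign into one at their barycentre changes the function only
  strictly between the two nodes, so the values at all nodes survive.
\<close>

lemma sparsify_interpolates:
  assumes x: "strict_mono_on {1..M} x" and j: "j \<in> {1..M}"
  shows "sparsify M x z (x j) = z j"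
proof -
  have "(\<Sum>p\<leftarrow>sparsify_pairs M x z. case p of (w, \<tau>) \<Rightarrow> w * max 0 (x j - \<tau>))
      = (\<Sum>m=2..M-1. pl_coeff x z m * max 0 (x j - x m))"
  proof (rule sum_list_sparsify_pairs)
    fix m assume m: "2 \<le> m" "m + 1 \<le> M - 1" and sgn: "0 < pl_coeff x z m * pl_coeff x z (m + 1)"
    define a b where "a = pl_coeff x z m" and "b = pl_coeff x z (m + 1)"
    define w \<tau> where "w = a + b" and "\<tau> = (a * x m + b * x (m + 1)) / w"
    have ab: "(0 < a \<and> 0 < b) \<or> (a < 0 \<and> b < 0)"
      using sgn by (auto simp: zero_less_mult_iff a_def b_def)
    then have w: "w \<noteq> 0" by (auto simp: w_def)
    have lt: "x m < x (m + 1)" using m by (intro strict_mono_onD[OF x]) auto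
    have "\<tau> - x m = b / w * (x (m + 1) - x m)" "x (m + 1) - \<tau> = a / w * (x (m + 1) - x m)"
      using w by (simp_all add: \<tau>_def w_def field_simps)
    moreover have "0 \<le> b / w" "0 \<le> a / w"
      using ab by (auto simp: w_def zero_le_divide_iff)
    ultimately have \<tau>: "x m \<le> \<tau>" "\<tau> \<le> x (m + 1)"
      using lt by (metis diff_ge_0_iff_ge less_imp_le mult_nonneg_nonneg)+
    have "w * max 0 (x j - \<tau>) = a * max 0 (x j - x m) + b * max 0 (x j - x (m + 1))"
    proof (cases "j \<le> m")
      case True
      then have "x j \<le> x m" using j m by (intro strict_mono_on_leD[OF x]) auto
      then show ?thesis using \<tau> lt by (simp add: max_def)
    next
      case False
      then have "x (m + 1) \<le> x j" using j m by (intro strict_mono_on_leD[OF x]) auto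
      then have "w * max 0 (x j - \<tau>) = w * x j - w * \<tau>" "max 0 (x j - x m) = x j - x m"
          "max 0 (x j - x (m + 1)) = x j - x (m + 1)"
        using \<tau> lt by (simp_all add: right_diff_distrib)
      moreover have "w * \<tau> = a * x m + b * x (m + 1)" using w by (simp add: \<tau>_def)
      ultimately show ?thesis by (simp add: w_def algebra_simps)
    qed
    then show "(case merge_pair x z m of (w, \<tau>) \<Rightarrow> w * max 0 (x j - \<tau>))
        = pl_coeff x z m * max 0 (x j - x m) + pl_coeff x z (m + 1) * max 0 (x j - x (m + 1))"
      by (simp add: merge_pair_def Let_def w_def \<tau>_def a_def b_def)
  qed auto
  then show ?thesis
    using linear_interpolation[OF x j, of z] by (simp add: sparsify_def)
qed

section \<open>Uniqueness of the fitted samples\<close>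

lemma L_op_midpoint: "L_op x (\<lambda>m. (z m + z' m) / 2) i = (L_op x z i + L_op x z' i) / 2"
  by (simp add: L_op_def algebra_simps add_divide_distrib)

text \<open>
  If the samples differed, the midpoint would have strictly smaller cost: the data term is strictly
  convex in each sample and the penalty is convex.
\<close>

lemma discrete_minimizer_unique:
  assumes convex: "\<And>w. strictly_convex (\<lambda>u. E u w)" and lam: "lam > 0"
    and z: "is_arg_min (discrete_cost M x y E lam) (\<lambda>_. True) z"
    and z': "discrete_cost M x y E lam z' \<le> discrete_cost M x y E lam z"
    and m: "m \<in> {1..M}"
  shows "z' m = z m"
proof (rule ccontr)
  assume ne: "z' m \<noteq> z m"
  define w where "w = (\<lambda>m. (z m + z' m) / 2)"
  have strict: "E (w k) v < (E (z k) v + E (z' k) v) / 2" if "z k \<noteq> z' k" for k v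
  proof -
    have "E ((1 - 1 / 2) * z k + 1 / 2 * z' k) v < (1 - 1 / 2) * E (z k) v + 1 / 2 * E (z' k) v"
      by (rule convex[unfolded strictly_convex_def, rule_format, OF that]) simp_all
    then show ?thesis by (simp add: w_def add_divide_distrib)
  qed
  have "(\<Sum>k=1..M. E (w k) (y k)) < (\<Sum>k=1..M. (E (z k) (y k) + E (z' k) (y k)) / 2)"
  proof (rule sum_strict_mono_ex1)
    show "\<forall>k\<in>{1..M}. E (w k) (y k) \<le> (E (z k) (y k) + E (z' k) (y k)) / 2"
    proof
      fix k
      show "E (w k) (y k) \<le> (E (z k) (y k) + E (z' k) (y k)) / 2"
        using strict[of k "y k"] by (cases "z k = z' k") (auto simp: w_def)
    qed
    show "\<exists>k\<in>{1..M}. E (w k) (y k) < (E (z k) (y k) + E (z' k) (y k)) / 2"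
      using strict m ne by metis
  qed simp
  moreover have "lam * (\<Sum>i=1..M-2. \<bar>L_op x w i\<bar>) \<le> lam * (\<Sum>i=1..M-2. (\<bar>L_op x z i\<bar> + \<bar>L_op x z' i\<bar>) / 2)"
    unfolding w_def L_op_midpoint using lam by (intro mult_left_mono sum_mono) auto
  ultimately have "discrete_cost M x y E lam w
      < (discrete_cost M x y E lam z + discrete_cost M x y E lam z') / 2"
    by (simp add: discrete_cost_def sum.distrib sum_divide_distrib[symmetric] algebra_simps add_divide_distrib)
  moreover have "discrete_cost M x y E lam z \<le> discrete_cost M x y E lam w"
    using z by (simp add: is_arg_min_def not_less)
  ultimately show False using z' by simp
qed

section \<open>Sparsest solutions\<close>

theorem proposition9:
  fixes M :: nat and x y y_lam :: "nat \<Rightarrow> real"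
    and E :: "real \<Rightarrow> real \<Rightarrow> real" and lam :: real
    and f_opt :: "real \<Rightarrow> real"
  assumes "M \<ge> 2"
    and "strict_mono_on {1..M} x"
    and "\<And>z w. E z w \<ge> 0"
    and "\<And>w. strictly_convex (\<lambda>z. E z w)"
    and "\<And>w. coercive (\<lambda>z. E z w)"
    and "\<And>w z. (\<lambda>z. E z w) differentiable (at z)"
    and "lam > 0"
    and "is_arg_min (discrete_cost M x y E lam) (\<lambda>_. True) y_lam"
    and "f_opt = sparsify M x y_lam"
  shows "sparsest_gBLASSO_solution M x y E lam f_opt \<and>
         pl_spline_with_sparsity f_opt (K_min M x y_lam)"
proof -
  note M = assms(1) and x = assms(2) and lam = assms(7) and f_opt = assms(9)
  let ?cost = "gBLASSO_cost M x y E lam" and ?dcost = "discrete_cost M x y E lam"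
  let ?A = "\<Sum>m=2..M-1. \<bar>pl_coeff x y_lam m\<bar>"
  have interp: "f_opt (x m) = y_lam m" if "m \<in> {1..M}" for m
    unfolding f_opt using sparsify_interpolates[OF x that] .
  have dmin: "?dcost y_lam \<le> ?dcost z" for z
    using assms(8) by (auto simp: is_arg_min_def not_less)
  have lower: "?dcost (\<lambda>m. g (x m)) \<le> ?cost g" if "g \<in> BV2" for g
    using sum_abs_pl_coeff_le_tv_norm[OF x M that refl] lam
    by (simp add: discrete_cost_def gBLASSO_cost_def sum_abs_L_op[OF M, unfolded One_nat_def])
  obtain K where K: "K \<le> K_min M x y_lam" "pl_spline_with_sparsity f_opt K"
    using linear_spline_of_list(1)[of "sparsify_pairs M x y_lam"]
    unfolding f_opt sparsify_def length_sparsify_pairs by blast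
  then have BV: "f_opt \<in> BV2" by (simp add: pl_spline_with_sparsity_def)
  have tv: "tv_norm (D2 f_opt) \<le> ?A"
    unfolding f_opt sparsify_def sum_abs_weights_sparsify_pairs[symmetric]
    by (rule linear_spline_of_list(2))
  then have upper: "?cost f_opt \<le> ?dcost y_lam"
    using lam by (simp add: discrete_cost_def gBLASSO_cost_def interp sum_abs_L_op[OF M, unfolded One_nat_def])
  have sol: "gBLASSO_solution M x y E lam f_opt"
    unfolding gBLASSO_solution_def is_arg_min_def not_less
    using BV order_trans[OF upper order_trans[OF dmin lower]] by (auto simp: not_less)
  have sparse: "K_min M x y_lam \<le> K'"
    if g: "gBLASSO_solution M x y E lam g" "pl_spline_with_sparsity g K'" for g K'
  proof -
    have gBV: "g \<in> BV2" using g(2) by (simp add: pl_spline_with_sparsity_def)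
    have "?cost g \<le> ?cost f_opt"
      using g(1) BV unfolding gBLASSO_solution_def is_arg_min_def by (auto simp: not_less)
    then have le: "?cost g \<le> ?dcost y_lam" using upper by simp
    have samples: "g (x m) = y_lam m" if "m \<in> {1..M}" for m
      using discrete_minimizer_unique[OF assms(4) lam assms(8) order_trans[OF lower[OF gBV] le] that] .
    have "lam * tv_norm (D2 g) \<le> lam * ?A"
      using le by (simp add: discrete_cost_def gBLASSO_cost_def samples sum_abs_L_op[OF M, unfolded One_nat_def])
    then have "tv_norm (D2 g) \<le> ?A" using lam by simp
    then have "card (alternate_nodes M x y_lam) \<le> K'"
      using g(2) samples
      by (intro card_le_sparsity_if_minimal_variation[OF x M] alternate_nodes_subset
          coeff_sign_alternate_node coeff_sign_adjacent_alternate_nodes)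
    then show ?thesis by (simp add: card_alternate_nodes)
  qed
  have "K = K_min M x y_lam" using sparse[OF sol K(2)] K(1) by simp
  with K sol sparse show ?thesis
    unfolding sparsest_gBLASSO_solution_def by blast
qed

end
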